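(* For $n\ge1$ and $x\ge 0$ let $\phi_n(x)=\int_0^\pi e^{-2x\sin\eta}\cos(2n\eta)\,d\eta$. Let $K_0:(0,\infty)\to\mathbb R$ be a $C^\infty$ function such that $-K_0'$ is a nontrivial completely monotone function and $\int_0^1|K_0(t)|t^{-\alpha}\,dt<\infty$ for some $\alpha\in(0,1)$, and set $$\lambda_n=\int_0^{2\pi}K_0\!\left(2\left|\sin\tfrac{\eta}{2}\right|\right)\cos(n\eta)\,d\eta,\qquad n\ge1 .$$ Then: 1. For every $n\ge1$ and $x>0$, $\phi_n(x)>0$, and for every $x>0$ the map $n\mapsto\phi_n(x)$ is strictly decreasing. 2. For each $n\ge1$, $\lambda_n>0$, and the sequence $(\lambda_n)_{n\ge1}$ is strictly decreasing. 3. Let $\mathcal S=\{\lambda_1-\lambda_n:\ n\ge1\}$. For $\Omega\in\mathcal S$, the kernel of $L_\Omega:X_\alpha\to Y_\alpha$ is one-dimensional, and $$\ker L_\Omega=\operatorname{span}\{w^{n+1}\}\qquad\text{when }\Omega=\lambda_1-\lambda_n,\ n\ge1 .$$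
   Context: A $C^\infty$ function $g:(0,\infty)\to\mathbb R$ is completely monotone if $(-1)^kg^{(k)}(t)\ge0$ for all $t>0$ and $k\ge0$. $\mathbb T$ is the unit circle in $\mathbb C$. The spaces (over $\mathbb R$) are $$X_\alpha=\Bigl\{h\in C^{1+\alpha}(\mathbb T):h(w)=\sum_{n\ge2}h_nw^n,\ h_n\in\mathbb R\Bigr\},\qquad Y_\alpha=\Bigl\{g\in C^{1+\alpha}(\mathbb T):g(w)=\sum_{n\ge1}g_n\operatorname{Re}(w^n),\ g_n\in\mathbb R\Bigr\},$$ and for $\Omega\in\mathbb R$ and $h\in X_\alpha$, $$L_\Omega h(w)=(\Omega-\lambda_1)\operatorname{Re}\bigl(\overline w h(w)\bigr)+\int_{\mathbb T}K_0(|w-\xi|)\operatorname{Re}\bigl(\overline\xi h(\xi)\bigr)\,|d\xi|,\qquad w\in\mathbb T,$$ where $|d\xi|$ is arc length. *)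

theory Defs
  imports "HOL-Analysis.Analysis" "HOL-Library.Function_Algebras"
begin

definition smooth_pos :: "(real \<Rightarrow> real) \<Rightarrow> bool" where
  "smooth_pos g \<longleftrightarrow> (\<forall>k. \<forall>t>0. (deriv ^^ k) g field_differentiable (at t))"

definition completely_monotone :: "(real \<Rightarrow> real) \<Rightarrow> bool" where
  "completely_monotone g \<longleftrightarrow>
     smooth_pos g \<and> (\<forall>k. \<forall>t>0. (-1) ^ k * (deriv ^^ k) g t \<ge> 0)"

definition phi :: "nat \<Rightarrow> real \<Rightarrow> real" where
  "phi n x = (LINT \<eta>:{0..pi}|lborel. exp (- 2 * x * sin \<eta>) * cos (2 * real n * \<eta>))"

definition lam :: "(real \<Rightarrow> real) \<Rightarrow> nat \<Rightarrow> real" where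
  "lam K n = (LINT \<eta>:{0..2*pi}|lborel. K (2 * \<bar>sin (\<eta> / 2)\<bar>) * cos (real n * \<eta>))"

abbreviation circle :: "complex set" where
  "circle \<equiv> sphere 0 1"

text \<open>
  A function on the unit circle is represented by its extension by zero to the complex
  plane, so that these functions form a real vector space with extensional equality.
  The derivative along the circle is taken in the arc length parameter.
\<close>

definition C1_Holder_circle :: "real \<Rightarrow> (complex \<Rightarrow> 'a::real_normed_vector) set" where
  "C1_Holder_circle \<alpha> = {f. (\<forall>w. w \<notin> circle \<longrightarrow> f w = 0) \<and>
     (\<exists>f'. (\<forall>t. ((\<lambda>t. f (cis t)) has_vector_derivative f' t) (at t)) \<and>
       (\<exists>C. \<forall>s t. norm (f' s - f' t) \<le> C * dist (cis s) (cis t) powr \<alpha>))}"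

text \<open>
  The expansions are understood as uniformly convergent series on the circle; for
  \<open>C\<^sup>1\<^sup>+\<^sup>\<alpha>\<close> functions this is the same as being the Fourier series.
\<close>

definition X_space :: "real \<Rightarrow> (complex \<Rightarrow> complex) set" where
  "X_space \<alpha> = {h \<in> C1_Holder_circle \<alpha>. \<exists>a :: nat \<Rightarrow> real.
     uniform_limit circle (\<lambda>N w. \<Sum>n=2..N. of_real (a n) * w ^ n) h sequentially}"

definition Y_space :: "real \<Rightarrow> (complex \<Rightarrow> real) set" where
  "Y_space \<alpha> = {g \<in> C1_Holder_circle \<alpha>. \<exists>a :: nat \<Rightarrow> real.
     uniform_limit circle (\<lambda>N w. \<Sum>n=1..N. a n * Re (w ^ n)) g sequentially}"

text \<open>The integral over the circle is written in the arc length parameter \<open>\<xi> = cis \<eta>\<close>.\<close>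

definition L_op :: "(real \<Rightarrow> real) \<Rightarrow> real \<Rightarrow> (complex \<Rightarrow> complex) \<Rightarrow> complex \<Rightarrow> real" where
  "L_op K \<Omega> h = (\<lambda>w. if w \<in> circle then
       (\<Omega> - lam K 1) * Re (cnj w * h w)
       + (LINT \<eta>:{0..2*pi}|lborel.
            K (cmod (w - cis \<eta>)) * Re (cnj (cis \<eta>) * h (cis \<eta>)))
     else 0)"

definition L_ker :: "real \<Rightarrow> (real \<Rightarrow> real) \<Rightarrow> real \<Rightarrow> (complex \<Rightarrow> complex) set" where
  "L_ker \<alpha> K \<Omega> = {h \<in> X_space \<alpha>. L_op K \<Omega> h = (\<lambda>w. 0)}"

definition circle_power :: "nat \<Rightarrow> complex \<Rightarrow> complex" where
  "circle_power m = (\<lambda>w. if w \<in> circle then w ^ m else 0)"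

definition fun_scale :: "real \<Rightarrow> (complex \<Rightarrow> complex) \<Rightarrow> complex \<Rightarrow> complex" where
  "fun_scale c f = (\<lambda>w. c *\<^sub>R f w)"

interpretation funs: vector_space fun_scale
  by unfold_locales (auto simp: fun_scale_def fun_eq_iff algebra_simps)

end

theory Submission
  imports Defs
begin

text \<open>
  Both \<open>\<phi>\<^sub>n(x)\<close> and \<open>\<lambda>\<^sub>n / 2\<close> are coefficients \<open>\<integral>\<^sub>0\<^sup>\<pi> K(2 sin \<theta>) cos 2n\<theta> d\<theta>\<close>, the former with
  \<open>K(t) = exp(-xt)\<close>. No integral representation of \<open>K\<close> (Bernstein's theorem) is needed: the signs
  of its first four derivatives suffice. Write \<open>K\<close> as its quadratic Taylor polynomial at \<open>2\<close> plus
  a remainder \<open>R\<close>. The polynomial contributes explicit positive terms decreasing in \<open>n\<close>. For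
  \<open>v(\<theta>) = R(2 sin \<theta>)\<close>, three integrations by parts over \<open>[0, \<pi>/2]\<close> give \<open>-\<integral> v''' P\<^sub>n\<close> with
  \<open>v''' \<le> 0\<close> and \<open>P\<^sub>n(\<theta>) = \<theta>/4n\<^sup>2 - sin(2n\<theta>)/8n\<^sup>3\<close>, which is nonnegative and decreasing in \<open>n\<close>
  by the Cusa-Huygens inequality \<open>3 sin y \<le> y (2 + cos y)\<close>. Strictness comes from \<open>K' < 0\<close>, since
  a completely monotone function with a zero vanishes. A singular \<open>K\<close> is the limit of \<open>K(t + \<epsilon>)\<close>.

  The operator acts on Fourier series as the multiplier \<open>\<Omega> - \<lambda>\<^sub>1 + \<lambda>\<^sub>m\<close>, and strict monotonicity of
  \<open>\<lambda>\<close> leaves a single resonant mode when \<open>\<Omega> = \<lambda>\<^sub>1 - \<lambda>\<^sub>n\<close>.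
\<close>

section \<open>Completely monotone functions\<close>

lemma smooth_posD:
  assumes "smooth_pos g" "0 < t"
  shows "((deriv ^^ k) g has_real_derivative (deriv ^^ Suc k) g t) (at t)"
  using assms unfolding smooth_pos_def by (simp add: field_differentiable_derivI)

lemma completely_monotoneD:
  assumes "completely_monotone g" "0 < t"
  shows "0 \<le> (-1) ^ k * (deriv ^^ k) g t"
  using assms unfolding completely_monotone_def by simp

lemma completely_monotone_imp_smooth_pos: "completely_monotone g \<Longrightarrow> smooth_pos g"
  by (simp add: completely_monotone_def)

lemma completely_monotone_antimono:
  assumes g: "completely_monotone g" and st: "0 < s" "s \<le> t"
  shows "(-1) ^ k * (deriv ^^ k) g t \<le> (-1) ^ k * (deriv ^^ k) g s"
proof (rule DERIV_nonpos_imp_nonincreasing[OF st(2)])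
  fix x assume "s \<le> x" "x \<le> t"
  then have x: "0 < x" using st by linarith
  have "((\<lambda>t. (-1) ^ k * (deriv ^^ k) g t) has_real_derivative
      (-1) ^ k * (deriv ^^ Suc k) g x) (at x)"
    by (intro DERIV_cmult smooth_posD completely_monotone_imp_smooth_pos g x)
  moreover have "(-1) ^ k * (deriv ^^ Suc k) g x \<le> 0"
    using completely_monotoneD[OF g x, of "Suc k"] by simp
  ultimately show "\<exists>y. ((\<lambda>t. (-1) ^ k * (deriv ^^ k) g t) has_real_derivative y) (at x) \<and> y \<le> 0"
    by blast
qed

text \<open>Expanding about \<open>t\<close> and evaluating to the left of it, the alternating signs
  of the derivatives cancel those of the powers of \<open>r - t\<close>. All Taylor terms and the
  Lagrange remainder are thus nonnegative, and a single term is at most the whole sum.\<close>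

lemma completely_monotone_Taylor_term_le:
  assumes g: "completely_monotone g" and rt: "0 < r" "r < t"
  shows "(-1) ^ N * (deriv ^^ N) g t / fact N * (t - r) ^ N \<le> g r"
proof -
  have "\<exists>\<xi>>r. \<xi> < t \<and> g r = (\<Sum>m<Suc N. (deriv ^^ m) g t / fact m * (r - t) ^ m)
      + (deriv ^^ Suc N) g \<xi> / fact (Suc N) * (r - t) ^ Suc N"
    by (rule Taylor_down[where b = t])
      (use rt smooth_posD[OF completely_monotone_imp_smooth_pos[OF g]] in auto)
  then obtain \<xi> where \<xi>: "r < \<xi>"
    and eq: "g r = (\<Sum>m<Suc N. (deriv ^^ m) g t / fact m * (r - t) ^ m)
      + (deriv ^^ Suc N) g \<xi> / fact (Suc N) * (r - t) ^ Suc N" by blast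
  have sgn: "(deriv ^^ m) g x / fact m * (r - t) ^ m =
      (-1) ^ m * (deriv ^^ m) g x / fact m * (t - r) ^ m" for m x
    using power_mult_distrib[of "-1" "t - r" m] by simp
  have nonneg: "0 \<le> (-1) ^ m * (deriv ^^ m) g x / fact m * (t - r) ^ m" if "0 < x" for m x
    using completely_monotoneD[OF g that, of m] rt by simp
  have "(-1) ^ N * (deriv ^^ N) g t / fact N * (t - r) ^ N
      \<le> (\<Sum>m<Suc N. (-1) ^ m * (deriv ^^ m) g t / fact m * (t - r) ^ m)"
    by (rule member_le_sum) (use nonneg rt in auto)
  also have "\<dots> \<le> g r"
    unfolding eq sgn using nonneg[of \<xi> "Suc N"] \<xi> rt by linarith
  finally show ?thesis .
qed

text \<open>Beyond \<open>c\<close> the function vanishes with all its derivatives, so its expansion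
  about a point to the right of \<open>c\<close> is pure remainder. The bound on single Taylor terms
  makes this remainder decay geometrically in the order. This replaces an appeal to
  analyticity.\<close>

lemma completely_monotone_zero_propagates:
  assumes g: "completely_monotone g" and c: "0 < c" "g c = 0"
  shows "g (3 / 4 * c) = 0"
proof -
  have nonneg: "0 \<le> g x" if "0 < x" for x
    using completely_monotoneD[OF g that, of 0] by simp
  have zero: "(deriv ^^ m) g x = 0" if "c < x" for m x
    using that
  proof (induction m arbitrary: x)
    case 0
    show ?case
      using completely_monotone_antimono[OF g c(1), of x 0] nonneg[of x] 0 c by simp
  next
    case (Suc m)
    have "((deriv ^^ m) g has_real_derivative 0) (at x)"
      by (rule has_field_derivative_transform_within_open[of "\<lambda>x. 0" _ _ "{c<..}"])
        (use Suc in auto)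
    then show ?case by (simp add: DERIV_imp_deriv)
  qed
  \<comment> \<open>All derivatives vanish at \<open>d\<close>, since it lies beyond
    \<open>c\<close>. The ratio of \<open>d - t\<close> to \<open>t - r\<close> is 3/5, and that it
    is below 1 makes the bound geometric.\<close>
  define r t d where "r = c / 8" and "t = 3 / 4 * c" and "d = 9 / 8 * c"
  have pos: "0 < r" "r < t" "t < d" "c < d" using c by (auto simp: r_def t_def d_def)
  have bound: "g t \<le> (3 / 5) ^ N * g r" if "0 < N" for N
  proof -
    have "\<exists>\<xi>>t. \<xi> < d \<and> g t = (\<Sum>m<N. (deriv ^^ m) g d / fact m * (t - d) ^ m)
        + (deriv ^^ N) g \<xi> / fact N * (t - d) ^ N"
      by (rule Taylor_down[where b = d])
        (use that pos smooth_posD[OF completely_monotone_imp_smooth_pos[OF g]] in auto)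
    then obtain \<xi> where \<xi>: "t < \<xi>" and "g t = (deriv ^^ N) g \<xi> / fact N * (t - d) ^ N"
      using zero[OF pos(4)] by auto
    then have "g t = ((-1) ^ N * (deriv ^^ N) g \<xi>) / fact N * (d - t) ^ N"
      using power_mult_distrib[of "-1" "d - t" N] by simp
    \<comment> \<open>This trades the intermediate point \<xi>, which varies with \<open>N\<close>,
      for the fixed point \<open>t\<close>.\<close>
    also have "\<dots> \<le> ((-1) ^ N * (deriv ^^ N) g t) / fact N * (d - t) ^ N"
      by (intro mult_right_mono divide_right_mono completely_monotone_antimono[OF g]) (use \<xi> pos in auto)
    also have "\<dots> = (3 / 5) ^ N * ((-1) ^ N * (deriv ^^ N) g t / fact N * (t - r) ^ N)"
    proof -
      have "d - t = 3 / 5 * (t - r)" by (simp add: r_def t_def d_def)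
      then have "(d - t) ^ N = (3 / 5) ^ N * (t - r) ^ N" by (simp only: power_mult_distrib)
      then show ?thesis by simp
    qed
    also have "\<dots> \<le> (3 / 5) ^ N * g r"
      by (intro mult_left_mono completely_monotone_Taylor_term_le[OF g]) (use pos in auto)
    finally show ?thesis .
  qed
  have "(\<lambda>N. (3 / 5 :: real) ^ N * g r) \<longlonglongrightarrow> 0 * g r"
    by (intro tendsto_mult LIMSEQ_realpow_zero tendsto_const) auto
  then have "g t \<le> 0"
    by (intro LIMSEQ_le_const[of _ "0" "g t"]) (use bound in \<open>auto intro!: exI[of _ 1]\<close>)
  moreover have "0 \<le> g t" using nonneg pos by auto
  ultimately show ?thesis by (simp add: t_def)
qed

text \<open>A zero propagates to the left by the factor 3/4, so one zero yields zeros arbitrarily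
  close to 0. As \<open>g\<close> is nonnegative and antitone, it would vanish at \<open>t\<close>
  as well.\<close>

lemma completely_monotone_pos:
  assumes g: "completely_monotone g" and nontrivial: "0 < t" "g t \<noteq> 0" and s: "0 < s"
  shows "0 < g s"
proof (rule ccontr)
  assume "\<not> 0 < g s"
  with completely_monotoneD[OF g s, of 0] have gs: "g s = 0" by simp
  have zero: "g ((3 / 4) ^ k * s) = 0" for k
  proof (induction k)
    case (Suc k)
    then show ?case
      using completely_monotone_zero_propagates[OF g, of "(3 / 4) ^ k * s"] s by (simp add: mult.assoc)
  qed (use gs in simp)
  obtain k where "(3 / 4 :: real) ^ k < t / s"
    using real_arch_pow_inv[of "t / s" "3 / 4"] s nontrivial by auto
  then have "(3 / 4) ^ k * s \<le> t" using s by (simp add: field_simps)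
  then have "g t \<le> g ((3 / 4) ^ k * s)"
    using completely_monotone_antimono[OF g, of "(3 / 4) ^ k * s" t 0] s by simp
  with zero[of k] completely_monotoneD[OF g nontrivial(1), of 0] nontrivial show False by simp
qed

section \<open>Fourier coefficients of regular kernels\<close>

text \<open>Up to pi, the difference of the two sides has derivative 2 - 2 cos y - y sin y, whose
  derivative is sin y - y cos y, whose derivative is y sin y; all of them vanish at 0. Beyond pi,
  the crude bounds 3 sin y <= 3 <= y suffice.\<close>

lemma cusa_huygens:
  fixes y :: real
  assumes "0 \<le> y"
  shows "3 * sin y \<le> y * (2 + cos y)"
proof (cases "y \<le> pi")
  case True
  have "(\<lambda>y::real. sin y - y * cos y) 0 \<le> (\<lambda>y. sin y - y * cos y) x" if "0 \<le> x" "x \<le> pi" for x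
  proof (rule DERIV_nonneg_imp_nondecreasing[OF that(1)])
    fix z :: real assume z: "0 \<le> z" "z \<le> x"
    show "\<exists>l. ((\<lambda>y. sin y - y * cos y) has_real_derivative l) (at z) \<and> 0 \<le> l"
      by (rule exI[of _ "z * sin z"])
        (use z that sin_ge_zero[of z] in \<open>auto intro!: derivative_eq_intros\<close>)
  qed
  then have s2: "0 \<le> sin x - x * cos x" if "0 \<le> x" "x \<le> pi" for x :: real
    using that by fastforce
  have "(\<lambda>y::real. 2 - 2 * cos y - y * sin y) 0 \<le> (\<lambda>y. 2 - 2 * cos y - y * sin y) x"
    if "0 \<le> x" "x \<le> pi" for x
  proof (rule DERIV_nonneg_imp_nondecreasing[OF that(1)])
    fix z :: real assume z: "0 \<le> z" "z \<le> x"
    show "\<exists>l. ((\<lambda>y. 2 - 2 * cos y - y * sin y) has_real_derivative l) (at z) \<and> 0 \<le> l"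
      by (rule exI[of _ "sin z - z * cos z"])
        (use z that s2[of z] in \<open>auto intro!: derivative_eq_intros\<close>)
  qed
  then have s1: "0 \<le> 2 - 2 * cos x - x * sin x" if "0 \<le> x" "x \<le> pi" for x :: real
    using that by fastforce
  have "(\<lambda>y::real. y * (2 + cos y) - 3 * sin y) 0 \<le> (\<lambda>y. y * (2 + cos y) - 3 * sin y) y"
  proof (rule DERIV_nonneg_imp_nondecreasing[OF assms])
    fix z :: real assume z: "0 \<le> z" "z \<le> y"
    show "\<exists>l. ((\<lambda>y. y * (2 + cos y) - 3 * sin y) has_real_derivative l) (at z) \<and> 0 \<le> l"
      by (rule exI[of _ "2 - 2 * cos z - z * sin z"])
        (use z True s1[of z] in \<open>auto intro!: derivative_eq_intros\<close>)
  qed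
  then show ?thesis by simp
next
  case False
  then have y: "3 \<le> y" using pi_gt3 by linarith
  have "3 * sin y \<le> 3 * 1" using sin_le_one[of y] by linarith
  also have "\<dots> \<le> y * 1" using y by simp
  also have "\<dots> \<le> y * (2 + cos y)"
    by (rule mult_left_mono) (use assms cos_ge_minus_one[of y] in linarith)+
  finally show ?thesis .
qed

text \<open>The third primitive of \<open>cos (2 * m * \<theta>)\<close> that vanishes with its first two derivatives at \<open>0\<close>.\<close>

definition fejer_primitive :: "real \<Rightarrow> real \<Rightarrow> real" where
  "fejer_primitive m \<theta> = \<theta> / (4 * m\<^sup>2) - sin (2 * m * \<theta>) / (8 * m ^ 3)"

lemma fejer_primitive_nonneg:
  assumes "0 < m" "0 \<le> \<theta>"
  shows "0 \<le> fejer_primitive m \<theta>"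
proof -
  have "fejer_primitive m \<theta> = (2 * m * \<theta> - sin (2 * m * \<theta>)) / (8 * m ^ 3)"
    using assms by (simp add: fejer_primitive_def field_simps power2_eq_square power3_eq_cube)
  then show ?thesis
    using assms sin_x_le_x[of "2 * m * \<theta>"] by simp
qed

text \<open>The frequency is real here so that one can differentiate in it. Up to a positive factor
  the derivative is 3 sin y - y (2 + cos y) at y = 2 m theta, and Cusa-Huygens gives its
  sign.\<close>

lemma fejer_primitive_antimono:
  assumes "0 < m" "m \<le> m'" "0 \<le> \<theta>"
  shows "fejer_primitive m' \<theta> \<le> fejer_primitive m \<theta>"
proof (rule DERIV_nonpos_imp_nonincreasing[OF assms(2)])
  fix x :: real assume x: "m \<le> x" "x \<le> m'"
  then have pos: "0 < x" using assms by linarith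
  let ?D = "(3 * sin (2 * x * \<theta>) - (2 * x * \<theta>) * (2 + cos (2 * x * \<theta>))) / (8 * x ^ 4)"
  have "((\<lambda>m. fejer_primitive m \<theta>) has_real_derivative ?D) (at x)"
  proof -
    have "((\<lambda>m. fejer_primitive m \<theta>) has_real_derivative
        (0 * (4 * x\<^sup>2) - \<theta> * (8 * x)) / ((4 * x\<^sup>2) * (4 * x\<^sup>2))
        - ((cos (2 * x * \<theta>) * (2 * \<theta>)) * (8 * x ^ 3) - sin (2 * x * \<theta>) * (24 * x\<^sup>2))
          / ((8 * x ^ 3) * (8 * x ^ 3))) (at x)"
      unfolding fejer_primitive_def
      by (intro DERIV_diff DERIV_divide) (use pos in \<open>auto intro!: derivative_eq_intros\<close>)
    \<comment> \<open>With the cosine and the sine abstracted to \<open>C\<close> and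
      \<open>S\<close>, the identity is purely rational.\<close>
    moreover have "(0 * (4 * x\<^sup>2) - \<theta> * (8 * x)) / ((4 * x\<^sup>2) * (4 * x\<^sup>2))
        - ((C * (2 * \<theta>)) * (8 * x ^ 3) - S * (24 * x\<^sup>2)) / ((8 * x ^ 3) * (8 * x ^ 3))
        = (3 * S - (2 * x * \<theta>) * (2 + C)) / (8 * x ^ 4)" for C S
      using pos by (simp add: divide_simps) algebra
    ultimately show ?thesis by simp
  qed
  moreover have "?D \<le> 0"
    using cusa_huygens[of "2 * x * \<theta>"] pos assms by (intro divide_nonpos_pos) auto
  ultimately show "\<exists>y. ((\<lambda>m. fejer_primitive m \<theta>) has_real_derivative y) (at x) \<and> y \<le> 0"
    by blast
qed

section \<open>Integrals of 1, sin and sin^2 against cos(2 n theta) over [0, pi/2]\<close>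

lemma has_integral_cos_half:
  assumes "1 \<le> (n::nat)"
  shows "((\<lambda>\<theta>. cos (2 * real n * \<theta>)) has_integral 0) {0..pi / 2}"
proof -
  have "((\<lambda>\<theta>. cos (2 * real n * \<theta>)) has_integral
      (sin (2 * real n * (pi / 2)) / (2 * real n) - sin (2 * real n * 0) / (2 * real n))) {0..pi / 2}"
    using assms
    by (intro fundamental_theorem_of_calculus)
      (auto intro!: derivative_eq_intros simp flip: has_real_derivative_iff_has_vector_derivative)
  then show ?thesis by simp
qed

lemma has_integral_sin_cos_half:
  assumes "1 \<le> (n::nat)"
  shows "((\<lambda>\<theta>. sin \<theta> * cos (2 * real n * \<theta>)) has_integral (- 1 / (4 * (real n)\<^sup>2 - 1))) {0..pi / 2}"
proof -
  let ?F = "\<lambda>\<theta>. (cos \<theta> * cos (2 * real n * \<theta>) + 2 * real n * sin \<theta> * sin (2 * real n * \<theta>))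
    / (4 * (real n)\<^sup>2 - 1)"
  have "1 \<le> (real n)\<^sup>2" using assms by simp
  then have nz: "4 * (real n)\<^sup>2 - 1 > 0" by linarith
  have "((\<lambda>\<theta>. sin \<theta> * cos (2 * real n * \<theta>)) has_integral (?F (pi / 2) - ?F 0)) {0..pi / 2}"
  proof (intro fundamental_theorem_of_calculus)
    fix x :: real
    have "(?F has_real_derivative sin x * cos (2 * real n * x)) (at x)"
    proof -
      have "((\<lambda>\<theta>. cos \<theta> * cos (2 * real n * \<theta>) + 2 * real n * sin \<theta> * sin (2 * real n * \<theta>))
          has_real_derivative (4 * (real n)\<^sup>2 - 1) * (sin x * cos (2 * real n * x))) (at x)"
        by (auto intro!: derivative_eq_intros simp: power2_eq_square algebra_simps)
      from DERIV_cdivide[OF this, of "4 * (real n)\<^sup>2 - 1"] show ?thesis using nz by simp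
    qed
    then show "(?F has_vector_derivative sin x * cos (2 * real n * x)) (at x within {0..pi / 2})"
      by (simp add: has_real_derivative_iff_has_vector_derivative has_vector_derivative_at_within)
  qed simp
  then show ?thesis by simp
qed

text \<open>Linearizing the product gives the frequencies 2n, 2(n + 1) and 2(n - 1). The last one
  degenerates to a constant for \<open>n = 1\<close>, hence the exceptional value.\<close>

lemma has_integral_sin_squared_cos_half:
  assumes "1 \<le> (n::nat)"
  shows "((\<lambda>\<theta>. (sin \<theta>)\<^sup>2 * cos (2 * real n * \<theta>)) has_integral (if n = 1 then - pi / 8 else 0)) {0..pi / 2}"
proof -
  have split: "(sin \<theta>)\<^sup>2 * cos (2 * real n * \<theta>) = cos (2 * real n * \<theta>) / 2
      - (cos (2 * real (n + 1) * \<theta>) + cos (2 * real (n - 1) * \<theta>)) / 4" for \<theta>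
  proof -
    have "2 * (sin \<theta>)\<^sup>2 = 1 - cos (2 * \<theta>)" by (simp add: cos_double_sin)
    moreover have "2 * cos (2 * \<theta>) * cos (2 * real n * \<theta>)
        = cos (2 * real (n + 1) * \<theta>) + cos (2 * real (n - 1) * \<theta>)"
    proof -
      have "2 * real (n + 1) * \<theta> = 2 * real n * \<theta> + 2 * \<theta>" by (simp add: algebra_simps)
      moreover have "2 * real (n - 1) * \<theta> = 2 * real n * \<theta> - 2 * \<theta>"
        using assms by (simp add: of_nat_diff algebra_simps)
      ultimately show ?thesis by (simp only: cos_add cos_diff) simp
    qed
    ultimately show ?thesis by algebra
  qed
  have low: "((\<lambda>\<theta>. cos (2 * real (n - 1) * \<theta>)) has_integral (if n = 1 then pi / 2 else 0)) {0..pi / 2}"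
  proof (cases "n = 1")
    case True
    then show ?thesis using has_integral_const_real[of "1::real" 0 "pi / 2"] by simp
  next
    case False
    then show ?thesis using has_integral_cos_half[of "n - 1"] assms by auto
  qed
  have "((\<lambda>\<theta>. cos (2 * real n * \<theta>) / 2
      - (cos (2 * real (n + 1) * \<theta>) + cos (2 * real (n - 1) * \<theta>)) / 4) has_integral
      (0 / 2 - (0 + (if n = 1 then pi / 2 else 0)) / 4)) {0..pi / 2}"
    by (intro has_integral_diff has_integral_divide has_integral_add has_integral_cos_half low)
      (use assms in auto)
  then show ?thesis unfolding split by (auto split: if_splits)
qed

text \<open>The interval [0, 2] is the range of 2 sin. Monotonicity of \<open>K3\<close> encodes the
  sign of the fourth derivative. The signs of \<open>K1\<close> and \<open>K2\<close> enter only at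
  the point 2, as hypotheses of \<open>sine_coeff_bounds\<close>.\<close>

locale thrice_differentiable_kernel =
  fixes K K1 K2 K3 :: "real \<Rightarrow> real"
  assumes deriv1: "0 \<le> t \<Longrightarrow> t \<le> 2 \<Longrightarrow> (K has_real_derivative K1 t) (at t)"
    and deriv2: "0 \<le> t \<Longrightarrow> t \<le> 2 \<Longrightarrow> (K1 has_real_derivative K2 t) (at t)"
    and deriv3: "0 \<le> t \<Longrightarrow> t \<le> 2 \<Longrightarrow> (K2 has_real_derivative K3 t) (at t)"
    and third_nonpos: "0 \<le> t \<Longrightarrow> t \<le> 2 \<Longrightarrow> K3 t \<le> 0"
    and third_mono: "0 \<le> s \<Longrightarrow> s \<le> t \<Longrightarrow> t \<le> 2 \<Longrightarrow> K3 s \<le> K3 t"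
begin

text \<open>The remainder \<open>R\<close> of the quadratic Taylor expansion of \<open>K\<close> at \<open>2\<close>. Unlike \<open>K\<close> itself, it
  makes \<open>(R \<circ> 2 sin)'''\<close> nonpositive on the first quadrant.\<close>

definition "R t = K t - K 2 + K1 2 * (2 - t) - K2 2 / 2 * (2 - t)\<^sup>2"
definition "R1 t = K1 t - K1 2 + K2 2 * (2 - t)"
definition "R2 t = K2 t - K2 2"

section \<open>Sign of the third derivative of the Taylor remainder along 2 sin\<close>

lemma R_derivs:
  assumes "0 \<le> t" "t \<le> 2"
  shows "(R has_real_derivative R1 t) (at t)" "(R1 has_real_derivative R2 t) (at t)"
    "(R2 has_real_derivative K3 t) (at t)"
  unfolding R_def R1_def R2_def
  using deriv1[OF assms] deriv2[OF assms] deriv3[OF assms]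
  by (auto intro!: derivative_eq_intros simp: field_simps)

lemma R_at_2: "R 2 = 0" "R1 2 = 0" "R2 2 = 0"
  by (simp_all add: R_def R1_def R2_def)

text \<open>\<open>R2\<close> vanishes at 2, so by the mean value theorem it equals
  \<open>(2 - t) * - K3 z\<close> for some \<open>z\<close> to the right of \<open>t\<close>; the
  sign and the monotonicity of \<open>K3\<close> then give both bounds.\<close>

lemma R2_bounds:
  assumes "0 \<le> t" "t \<le> 2"
  shows "0 \<le> R2 t" "R2 t \<le> (2 - t) * - K3 t"
proof -
  have "0 \<le> R2 t \<and> R2 t \<le> (2 - t) * - K3 t"
  proof (cases "t = 2")
    case False
    then obtain z where z: "t < z" "z < 2" "R2 2 - R2 t = (2 - t) * K3 z"
      using MVT2[of t 2 R2 K3] R_derivs(3) assms by auto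
    moreover have "(2 - t) * K3 t \<le> (2 - t) * K3 z" "(2 - t) * K3 z \<le> 0"
      using third_mono[of t z] third_nonpos[of z] z assms
      by (auto intro: mult_left_mono mult_nonneg_nonpos)
    ultimately show ?thesis unfolding mult_minus_right using R_at_2(3) by linarith
  qed (simp add: R_at_2)
  then show "0 \<le> R2 t" "R2 t \<le> (2 - t) * - K3 t" by auto
qed

text \<open>The mean value argument once more, now applied to \<open>R1\<close> with the bound on
  \<open>R2\<close>.\<close>

lemma R1_bound:
  assumes "0 \<le> t" "t \<le> 2"
  shows "- R1 t \<le> (2 - t)\<^sup>2 * - K3 t"
proof (cases "t = 2")
  case False
  then obtain z where z: "t < z" "z < 2" "R1 2 - R1 t = (2 - t) * R2 z"
    using MVT2[of t 2 R1 R2] R_derivs(2) assms by auto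
  have "R2 z \<le> (2 - z) * - K3 z" using R2_bounds[of z] z assms by simp
  also have "\<dots> \<le> (2 - t) * - K3 t"
    using third_mono[of t z] third_nonpos[of z] z assms by (intro mult_mono) auto
  finally have "(2 - t) * R2 z \<le> (2 - t) * ((2 - t) * - K3 t)"
    using assms by (intro mult_left_mono) auto
  then show ?thesis using z R_at_2 by (simp add: power2_eq_square mult.assoc)
qed (simp add: R_at_2)

text \<open>The third derivative of \<open>R (2 * sin \<theta>)\<close> in \<theta>.\<close>

definition "V3 \<theta> = cos \<theta> * (8 * (cos \<theta>)\<^sup>2 * K3 (2 * sin \<theta>) - 12 * sin \<theta> * R2 (2 * sin \<theta>) - 2 * R1 (2 * sin \<theta>))"

text \<open>In the bracket only the \<open>R1\<close> term can be positive. With s = sin \<theta>,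
  \<open>R1_bound\<close> and (1 - s)^2 <= (1 - s)(1 + s) = cos^2 \<theta> show that the
  \<open>K3\<close> term absorbs it; the factor 8 is just large enough for this estimate.\<close>

lemma V3_nonpos:
  assumes "0 \<le> \<theta>" "\<theta> \<le> pi / 2"
  shows "V3 \<theta> \<le> 0"
proof -
  define s where "s = sin \<theta>"
  have c: "0 \<le> cos \<theta>" using assms by (intro cos_ge_zero) auto
  have s: "0 \<le> s" "s \<le> 1" unfolding s_def using assms by (auto intro!: sin_ge_zero)
  have "(1 - s)\<^sup>2 \<le> (1 - s) * (1 + s)"
    unfolding power2_eq_square using s by (intro mult_left_mono) auto
  also have "\<dots> = (cos \<theta>)\<^sup>2" by (simp add: s_def cos_squared_eq algebra_simps power2_eq_square)
  finally have "4 * (1 - s)\<^sup>2 * - K3 (2 * s) \<le> 4 * (cos \<theta>)\<^sup>2 * - K3 (2 * s)"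
    using third_nonpos[of "2 * s"] s by (intro mult_right_mono) auto
  moreover have "(2 - 2 * s)\<^sup>2 = 4 * (1 - s)\<^sup>2" by (simp add: power2_eq_square algebra_simps)
  ultimately have "4 * ((cos \<theta>)\<^sup>2 * K3 (2 * s)) \<le> R1 (2 * s)"
    using R1_bound[of "2 * s"] s by (simp add: mult_ac)
  moreover have "0 \<le> s * R2 (2 * s)" using R2_bounds(1)[of "2 * s"] s by simp
  ultimately have "8 * (cos \<theta>)\<^sup>2 * K3 (2 * s) - 12 * s * R2 (2 * s) - 2 * R1 (2 * s) \<le> 0"
    unfolding mult.assoc by linarith
  then show ?thesis
    unfolding V3_def s_def[symmetric] by (intro mult_nonneg_nonpos c)
qed

text \<open>Three integrations by parts, carried out at once: \<open>?F\<close> collects the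
  boundary terms, and its derivative is the integrand plus \<open>V3\<close> times the third
  primitive of the cosine.\<close>

lemma R_half_integral:
  assumes n: "1 \<le> (n::nat)"
  shows "((\<lambda>\<theta>. R (2 * sin \<theta>) * cos (2 * real n * \<theta>)) has_integral
      integral {0..pi / 2} (\<lambda>\<theta>. - V3 \<theta> * fejer_primitive (real n) \<theta>)) {0..pi / 2}"
    and "(\<lambda>\<theta>. - V3 \<theta> * fejer_primitive (real n) \<theta>) integrable_on {0..pi / 2}"
proof -
  let ?P1 = "\<lambda>\<theta>. sin (2 * real n * \<theta>) / (2 * real n)"
  let ?P2 = "\<lambda>\<theta>. (1 - cos (2 * real n * \<theta>)) / (4 * (real n)\<^sup>2)"
  let ?P3 = "fejer_primitive (real n)"
  let ?v = "\<lambda>\<theta>. R (2 * sin \<theta>)"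
  let ?v1 = "\<lambda>\<theta>. 2 * cos \<theta> * R1 (2 * sin \<theta>)"
  let ?v2 = "\<lambda>\<theta>. 4 * (cos \<theta>)\<^sup>2 * R2 (2 * sin \<theta>) - 2 * sin \<theta> * R1 (2 * sin \<theta>)"
  let ?F = "\<lambda>\<theta>. ?v \<theta> * ?P1 \<theta> - ?v1 \<theta> * ?P2 \<theta> + ?v2 \<theta> * ?P3 \<theta>"
  let ?g = "\<lambda>\<theta>. ?v \<theta> * cos (2 * real n * \<theta>)"
  have n0: "real n > 0" using n by simp
  have dP: "(?P1 has_real_derivative cos (2 * real n * x)) (at x)"
    "(?P2 has_real_derivative ?P1 x) (at x)"
    "(?P3 has_real_derivative ?P2 x) (at x)" for x
  proof -
    have s: "((\<lambda>\<theta>. sin (2 * real n * \<theta>)) has_real_derivative 2 * real n * cos (2 * real n * x)) (at x)"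
      "((\<lambda>\<theta>. 1 - cos (2 * real n * \<theta>)) has_real_derivative 2 * real n * sin (2 * real n * x)) (at x)"
      by (auto intro!: derivative_eq_intros)
    show "(?P1 has_real_derivative cos (2 * real n * x)) (at x)"
      by (rule DERIV_cong[OF DERIV_cdivide[OF s(1)]]) (use n0 in simp)
    show "(?P2 has_real_derivative ?P1 x) (at x)"
      by (rule DERIV_cong[OF DERIV_cdivide[OF s(2)]]) (use n0 in \<open>simp add: power2_eq_square\<close>)
    show "(?P3 has_real_derivative ?P2 x) (at x)"
      unfolding fejer_primitive_def
      by (rule DERIV_cong[OF DERIV_diff[OF DERIV_cdivide[OF DERIV_ident] DERIV_cdivide[OF s(1)]]])
        (use n0 in \<open>simp add: power2_eq_square power3_eq_cube diff_divide_distrib\<close>)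
  qed
  have rng: "0 \<le> 2 * sin x" "2 * sin x \<le> 2" if "x \<in> {0..pi / 2}" for x
    using that by (auto intro!: sin_ge_zero)
  have d2: "((\<lambda>\<theta>. 2 * sin \<theta>) has_real_derivative 2 * cos x) (at x)" for x :: real
    by (auto intro!: derivative_eq_intros)
  have dv: "(?v has_real_derivative ?v1 x) (at x)" "(?v1 has_real_derivative ?v2 x) (at x)"
    "(?v2 has_real_derivative V3 x) (at x)" if x: "x \<in> {0..pi / 2}" for x
  proof -
    note dR = R_derivs[OF rng[OF x]]
    have c: "((\<lambda>\<theta>. R (2 * sin \<theta>)) has_real_derivative R1 (2 * sin x) * (2 * cos x)) (at x)"
      "((\<lambda>\<theta>. R1 (2 * sin \<theta>)) has_real_derivative R2 (2 * sin x) * (2 * cos x)) (at x)"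
      "((\<lambda>\<theta>. R2 (2 * sin \<theta>)) has_real_derivative K3 (2 * sin x) * (2 * cos x)) (at x)"
      using DERIV_chain2[OF dR(1) d2] DERIV_chain2[OF dR(2) d2] DERIV_chain2[OF dR(3) d2] by simp_all
    have e: "((\<lambda>\<theta>. 2 * cos \<theta>) has_real_derivative - 2 * sin x) (at x)"
      "((\<lambda>\<theta>. 4 * (cos \<theta>)\<^sup>2) has_real_derivative - 8 * cos x * sin x) (at x)"
      by (auto intro!: derivative_eq_intros)
    show "(?v has_real_derivative ?v1 x) (at x)" using c(1) by (simp only: mult.commute)
    show "(?v1 has_real_derivative ?v2 x) (at x)"
      by (rule DERIV_cong[OF DERIV_mult[OF e(1) c(2)]]) (simp add: power2_eq_square algebra_simps)
    show "(?v2 has_real_derivative V3 x) (at x)"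
      unfolding V3_def
      by (rule DERIV_cong[OF DERIV_diff[OF DERIV_mult[OF e(2) c(3)] DERIV_mult[OF d2 c(2)]]])
        (simp add: power2_eq_square algebra_simps)
  qed
  have "((\<lambda>\<theta>. ?g \<theta> - (- V3 \<theta> * ?P3 \<theta>)) has_integral (?F (pi / 2) - ?F 0)) {0..pi / 2}"
  proof (intro fundamental_theorem_of_calculus)
    fix x assume x: "x \<in> {0..pi / 2}"
    have "(?F has_real_derivative (?v x * cos (2 * real n * x) + ?v1 x * ?P1 x)
        - (?v1 x * ?P1 x + ?v2 x * ?P2 x) + (?v2 x * ?P2 x + V3 x * ?P3 x)) (at x)"
      by (rule DERIV_cong[OF DERIV_add[OF DERIV_diff[OF DERIV_mult[OF dv(1)[OF x] dP(1)]
          DERIV_mult[OF dv(2)[OF x] dP(2)]] DERIV_mult[OF dv(3)[OF x] dP(3)]]]) (simp only: ac_simps)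
    then have "(?F has_real_derivative ?g x - (- V3 x * ?P3 x)) (at x)" by simp
    then show "(?F has_vector_derivative ?g x - (- V3 x * ?P3 x)) (at x within {0..pi / 2})"
      by (simp add: has_real_derivative_iff_has_vector_derivative has_vector_derivative_at_within)
  qed simp
  \<comment> \<open>At 0 the three primitives vanish; at pi/2 the argument of the remainder is 2,
    where \<open>R\<close>, \<open>R1\<close> and \<open>R2\<close> vanish.\<close>
  moreover have "?F (pi / 2) - ?F 0 = 0"
    by (simp add: R_at_2 fejer_primitive_def)
  ultimately have diff: "((\<lambda>\<theta>. ?g \<theta> - (- V3 \<theta> * ?P3 \<theta>)) has_integral 0) {0..pi / 2}" by (simp only:)
  have "continuous_on {0..pi / 2} ?g"
    using dv(1) by (intro continuous_on_mult continuous_intros)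
      (meson DERIV_isCont continuous_at_imp_continuous_on)
  then have g: "?g integrable_on {0..pi / 2}" by (rule integrable_continuous_real)
  \<comment> \<open>\<open>K3\<close> is not assumed continuous, so integrability of this product
    comes from writing it as a continuous function minus the derivative of
    \<open>?F\<close>.\<close>
  have eq: "(\<lambda>\<theta>. - V3 \<theta> * ?P3 \<theta>) = (\<lambda>\<theta>. ?g \<theta> - (?g \<theta> - (- V3 \<theta> * ?P3 \<theta>)))" by auto
  show V: "(\<lambda>\<theta>. - V3 \<theta> * ?P3 \<theta>) integrable_on {0..pi / 2}"
    by (subst eq) (intro integrable_diff g has_integral_integrable[OF diff])
  have "integral {0..pi / 2} ?g - integral {0..pi / 2} (\<lambda>\<theta>. - V3 \<theta> * ?P3 \<theta>) = 0"
    using integral_diff[OF g V] integral_unique[OF diff] by simp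
  then show "(?g has_integral integral {0..pi / 2} (\<lambda>\<theta>. - V3 \<theta> * ?P3 \<theta>)) {0..pi / 2}"
    using integrable_integral[OF g] by (simp only: right_minus_eq)
qed

definition "remainder_coeff n = integral {0..pi / 2} (\<lambda>\<theta>. - V3 \<theta> * fejer_primitive (real n) \<theta>)"

lemma remainder_coeff_nonneg: "1 \<le> n \<Longrightarrow> 0 \<le> remainder_coeff n"
  unfolding remainder_coeff_def
  by (intro integral_nonneg R_half_integral(2) mult_nonneg_nonneg fejer_primitive_nonneg)
    (use V3_nonpos in auto)

text \<open>Only the primitive depends on the frequency, and its weight \<open>- V3\<close> is
  nonnegative.\<close>

lemma remainder_coeff_antimono:
  assumes "1 \<le> m" "m \<le> n"
  shows "remainder_coeff n \<le> remainder_coeff m"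
  unfolding remainder_coeff_def
  by (intro integral_le R_half_integral(2) mult_left_mono fejer_primitive_antimono)
    (use V3_nonpos assms in auto)

text \<open>For \<open>n\<close> at least 1 this is the integral of (2 - 2 sin theta)^2 cos(2 n
  theta) over [0, pi/2].\<close>

definition "quadratic_coeff (n::nat) = (if n = 1 then 8 / 3 - pi / 2 else 8 / (4 * (real n)\<^sup>2 - 1))"

text \<open>The Taylor expansion at 2 is integrated term by term; the constant term has integral
  zero.\<close>

lemma half_integral:
  assumes n: "1 \<le> n"
  shows "((\<lambda>\<theta>. K (2 * sin \<theta>) * cos (2 * real n * \<theta>)) has_integral
    (- K1 2 * (2 / (4 * (real n)\<^sup>2 - 1)) + K2 2 / 2 * quadratic_coeff n + remainder_coeff n)) {0..pi / 2}"
proof -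
  let ?C = "\<lambda>\<theta>. cos (2 * real n * \<theta>)"
  have eq: "K (2 * sin \<theta>) * ?C \<theta> = (K 2 - 2 * K1 2 + 2 * K2 2) * ?C \<theta>
      + (2 * K1 2 - 4 * K2 2) * (sin \<theta> * ?C \<theta>) + 2 * K2 2 * ((sin \<theta>)\<^sup>2 * ?C \<theta>) + R (2 * sin \<theta>) * ?C \<theta>" for \<theta>
    by (simp add: R_def power2_eq_square algebra_simps)
  have "((\<lambda>\<theta>. K (2 * sin \<theta>) * ?C \<theta>) has_integral
      (K 2 - 2 * K1 2 + 2 * K2 2) * 0 + (2 * K1 2 - 4 * K2 2) * (- 1 / (4 * (real n)\<^sup>2 - 1))
      + 2 * K2 2 * (if n = 1 then - pi / 8 else 0) + remainder_coeff n) {0..pi / 2}"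
    unfolding eq remainder_coeff_def
    by (intro has_integral_add has_integral_mult_right has_integral_cos_half has_integral_sin_cos_half
        has_integral_sin_squared_cos_half R_half_integral(1) n)
  moreover have "(K 2 - 2 * K1 2 + 2 * K2 2) * 0 + (2 * K1 2 - 4 * K2 2) * (- 1 / (4 * (real n)\<^sup>2 - 1))
      + 2 * K2 2 * (if n = 1 then - pi / 8 else 0) + remainder_coeff n
      = - K1 2 * (2 / (4 * (real n)\<^sup>2 - 1)) + K2 2 / 2 * quadratic_coeff n + remainder_coeff n"
  proof (cases "n = 1")
    case False
    have "(2 * a - 4 * b) * (- 1 / N) + 2 * b * 0 = - a * (2 / N) + b / 2 * (8 / N)" for a b N :: real
      by (cases "N = 0") (simp_all add: divide_simps algebra_simps)
    then show ?thesis using False by (simp add: quadratic_coeff_def)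
  qed (simp add: quadratic_coeff_def algebra_simps)
  ultimately show ?thesis by simp
qed

lemma quadratic_coeff_nonneg: "1 \<le> n \<Longrightarrow> 0 \<le> quadratic_coeff n"
proof -
  assume "1 \<le> n"
  then have "1 \<le> (real n)\<^sup>2" by simp
  then have "0 \<le> 4 * (real n)\<^sup>2 - 1" by linarith
  then show ?thesis using pi_less_4 by (auto simp: quadratic_coeff_def)
qed

lemma quadratic_coeff_Suc:
  assumes "1 \<le> n"
  shows "quadratic_coeff (Suc n) \<le> quadratic_coeff n"
proof (cases "n = 1")
  case True
  \<comment> \<open>As pi < 4, the value at 1 exceeds 2/3, while the value at 2 is 8/15.\<close>
  then show ?thesis using pi_less_4 by (simp add: quadratic_coeff_def)
next
  case False
  have n1: "1 \<le> (real n)\<^sup>2" using assms by simp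
  have "(real n)\<^sup>2 \<le> (real (Suc n))\<^sup>2" by (intro power_mono) auto
  then have "8 / (4 * (real (Suc n))\<^sup>2 - 1) \<le> 8 / (4 * (real n)\<^sup>2 - 1)"
    using n1 by (intro divide_left_mono mult_pos_pos) (linarith | simp)+
  then show ?thesis using False assms by (simp add: quadratic_coeff_def)
qed

end

section \<open>Affine substitutions and the common form of both families of coefficients\<close>

lemma set_integrable_real_affine:
  fixes f :: "real \<Rightarrow> real"
  assumes "set_integrable lborel A f" "c \<noteq> 0"
  shows "set_integrable lborel {x. t + c * x \<in> A} (\<lambda>x. f (t + c * x))"
proof -
  have "indicat_real {x. t + c * x \<in> A} x = indicat_real A (t + c * x)" for x
    by (simp add: indicator_def)
  then show ?thesis
    using lborel_integrable_real_affine[of "\<lambda>x. indicat_real A x *\<^sub>R f x" c t] assms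
    by (simp add: set_integrable_def)
qed

lemma set_integral_real_affine:
  fixes f :: "real \<Rightarrow> real"
  assumes "c \<noteq> 0"
  shows "(LINT x:A|lborel. f x) = \<bar>c\<bar> * (LINT x:{x. t + c * x \<in> A}|lborel. f (t + c * x))"
proof -
  have "indicat_real {x. t + c * x \<in> A} x = indicat_real A (t + c * x)" for x
    by (simp add: indicator_def)
  then show ?thesis
    using lborel_integral_real_affine[of c "\<lambda>x. indicat_real A x *\<^sub>R f x" t] assms
    by (simp add: set_lebesgue_integral_def)
qed

definition sine_coeff :: "(real \<Rightarrow> real) \<Rightarrow> nat \<Rightarrow> real" where
  "sine_coeff K n = (LINT \<theta>:{0..pi}|lborel. K (2 * sin \<theta>) * cos (2 * real n * \<theta>))"

lemma phi_eq_sine_coeff: "phi n x = sine_coeff (\<lambda>t. exp (- x * t)) n"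
  by (simp add: phi_def sine_coeff_def mult_ac)

lemma lam_eq_sine_coeff: "lam K n = 2 * sine_coeff K n"
proof -
  have *: "{x. 0 + 2 * x \<in> {0..2 * pi}} = {0..pi}" by auto
  have "lam K n = 2 * (LINT x:{0..pi}|lborel. K (2 * \<bar>sin x\<bar>) * cos (real n * (2 * x)))"
    unfolding lam_def
    by (subst set_integral_real_affine[where c = 2 and t = 0]) (simp_all only: * , simp)
  also have "(LINT x:{0..pi}|lborel. K (2 * \<bar>sin x\<bar>) * cos (real n * (2 * x))) = sine_coeff K n"
    unfolding sine_coeff_def
    by (rule set_lebesgue_integral_cong) (auto simp: sin_ge_zero mult_ac)
  finally show ?thesis .
qed

context thrice_differentiable_kernel
begin

text \<open>The reflection of \<theta> in pi/2 preserves both factors of the integrand, so [0, pi]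
  contributes twice the integral over [0, pi/2].\<close>

lemma sine_coeff_eq:
  assumes n: "1 \<le> n"
  shows "sine_coeff K n =
    2 * (- K1 2 * (2 / (4 * (real n)\<^sup>2 - 1)) + K2 2 / 2 * quadratic_coeff n + remainder_coeff n)"
proof -
  let ?f = "\<lambda>\<theta>. K (2 * sin \<theta>) * cos (2 * real n * \<theta>)"
  have cont: "continuous_on {0..pi} ?f"
  proof (intro continuous_on_mult continuous_intros continuous_at_imp_continuous_on ballI)
    fix \<theta> assume "\<theta> \<in> {0..pi}"
    then have "isCont K (2 * sin \<theta>)"
      by (intro DERIV_isCont[OF deriv1]) (auto intro!: sin_ge_zero)
    then show "isCont (\<lambda>\<theta>. K (2 * sin \<theta>)) \<theta>"
      by (rule isCont_o2[rotated]) (intro continuous_intros)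
  qed
  have half: "(LINT \<theta>:{0..pi / 2}|lborel. ?f \<theta>) =
      - K1 2 * (2 / (4 * (real n)\<^sup>2 - 1)) + K2 2 / 2 * quadratic_coeff n + remainder_coeff n"
    using set_borel_integral_eq_integral(2)[OF borel_integrable_atLeastAtMost', of 0 "pi / 2" ?f]
      continuous_on_subset[OF cont, of "{0..pi / 2}"] integral_unique[OF half_integral[OF n]] by simp
  have *: "{x. pi + (- 1) * x \<in> {pi / 2..pi}} = {0..pi / 2}" by auto
  have "cos (2 * real n * (pi - \<theta>)) = cos (2 * real n * \<theta>)" for \<theta>
  proof -
    have "2 * real n * (pi - \<theta>) = real (2 * n) * pi - 2 * real n * \<theta>" by (simp add: algebra_simps)
    then show ?thesis by (simp only: cos_diff cos_npi sin_npi) simp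
  qed
  then have other: "(LINT \<theta>:{pi / 2..pi}|lborel. ?f \<theta>) = (LINT \<theta>:{0..pi / 2}|lborel. ?f \<theta>)"
    using set_integral_real_affine[where c = "-1" and t = pi and f = ?f and A = "{pi / 2..pi}"]
    unfolding * by simp
  have "sine_coeff K n = (LINT \<theta>:{0..pi / 2} \<union> {pi / 2..pi}|lborel. ?f \<theta>)"
    unfolding sine_coeff_def by (rule arg_cong[where f = "\<lambda>A. LINT \<theta>:A|lborel. ?f \<theta>"]) auto
  also have "\<dots> = (LINT \<theta>:{0..pi / 2}|lborel. ?f \<theta>) + (LINT \<theta>:{pi / 2..pi}|lborel. ?f \<theta>)"
  proof (rule set_integral_Un_AE)
    show "AE x in lborel. \<not> (x \<in> {0..pi / 2} \<and> x \<in> {pi / 2..pi})"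
      by (rule AE_mp[OF AE_lborel_singleton[of "pi / 2"]]) auto
    show "set_integrable lborel {0..pi / 2} ?f" "set_integrable lborel {pi / 2..pi} ?f"
      by (auto intro!: borel_integrable_atLeastAtMost' continuous_on_subset[OF cont])
  qed auto
  finally show ?thesis unfolding other half by simp
qed

text \<open>Of the three contributions only the linear one is estimated by a margin; the other two
  are nonnegative and antitone in \<open>n\<close>. An explicit margin \<open>A\<close>, in place of
  a strict inequality, survives the limit taken in \<open>lam_bounds\<close>.\<close>

lemma sine_coeff_bounds:
  assumes n: "1 \<le> n" and A: "A \<le> - K1 2" and K2: "0 \<le> K2 2"
  shows "A * (4 / (4 * (real n)\<^sup>2 - 1)) \<le> sine_coeff K n"
    and "A * (4 / (4 * (real n)\<^sup>2 - 1) - 4 / (4 * (real (Suc n))\<^sup>2 - 1))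
      \<le> sine_coeff K n - sine_coeff K (Suc n)"
proof -
  define a b where "a = 4 / (4 * (real n)\<^sup>2 - 1)" and "b = 4 / (4 * (real (Suc n))\<^sup>2 - 1)"
  have n1: "1 \<le> (real n)\<^sup>2" using n by simp
  have n2: "(real n)\<^sup>2 \<le> (real (Suc n))\<^sup>2" by (intro power_mono) auto
  have a0: "0 \<le> a" unfolding a_def using n1 by (intro divide_nonneg_nonneg) linarith+
  have ba: "b \<le> a"
    unfolding a_def b_def using n1 n2 by (intro divide_left_mono mult_pos_pos) (linarith | simp)+
  have eq: "sine_coeff K n = - K1 2 * a + K2 2 * quadratic_coeff n + 2 * remainder_coeff n"
    "sine_coeff K (Suc n) = - K1 2 * b + K2 2 * quadratic_coeff (Suc n) + 2 * remainder_coeff (Suc n)"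
    using n by (simp_all only: sine_coeff_eq a_def b_def) (simp_all add: algebra_simps)
  have "A * a \<le> - K1 2 * a" using A a0 by (rule mult_right_mono)
  moreover have "0 \<le> K2 2 * quadratic_coeff n"
    using K2 quadratic_coeff_nonneg[OF n] by simp
  ultimately show "A * (4 / (4 * (real n)\<^sup>2 - 1)) \<le> sine_coeff K n"
    using remainder_coeff_nonneg[OF n] unfolding eq a_def[symmetric] by linarith
  have "A * (a - b) \<le> - K1 2 * (a - b)" using A ba by (intro mult_right_mono) auto
  moreover have "K2 2 * quadratic_coeff (Suc n) \<le> K2 2 * quadratic_coeff n"
    using quadratic_coeff_Suc[OF n] K2 by (rule mult_left_mono)
  ultimately show "A * (4 / (4 * (real n)\<^sup>2 - 1) - 4 / (4 * (real (Suc n))\<^sup>2 - 1))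
      \<le> sine_coeff K n - sine_coeff K (Suc n)"
    using remainder_coeff_antimono[of n "Suc n"] n
    unfolding eq a_def[symmetric] b_def[symmetric] right_diff_distrib by linarith
qed

end

lemma linear_coeff_pos:
  assumes "1 \<le> (n::nat)"
  shows "0 < 4 / (4 * (real n)\<^sup>2 - 1)" "0 < 4 / (4 * (real n)\<^sup>2 - 1) - 4 / (4 * (real (Suc n))\<^sup>2 - 1)"
proof -
  have n1: "1 \<le> (real n)\<^sup>2" using assms by simp
  have n2: "(real n)\<^sup>2 < (real (Suc n))\<^sup>2" by (intro power_strict_mono) auto
  show "0 < 4 / (4 * (real n)\<^sup>2 - 1)" using n1 by (intro divide_pos_pos) linarith+
  show "0 < 4 / (4 * (real n)\<^sup>2 - 1) - 4 / (4 * (real (Suc n))\<^sup>2 - 1)"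
    using n1 n2 divide_strict_left_mono[of "4 * (real n)\<^sup>2 - 1" "4 * (real (Suc n))\<^sup>2 - 1" 4] by simp
qed

lemma strict_antimono_on_from_1:
  fixes f :: "nat \<Rightarrow> real"
  assumes "\<And>n. 1 \<le> n \<Longrightarrow> f (Suc n) < f n"
  shows "strict_antimono_on {1..} f"
proof (rule monotone_onI)
  fix m n :: nat assume "m \<in> {1..}" "n \<in> {1..}" and "m < n"
  then obtain i j where "m = Suc i" "n = Suc j" "i < j"
    by (metis Suc_less_eq atLeast_iff not0_implies_Suc not_one_le_zero)
  then show "f m > f n"
    using lift_Suc_mono_less[of "\<lambda>k. - f (Suc k)" i j] assms by simp
qed

lemma phi_bounds:
  assumes n: "1 \<le> n" and x: "0 < x"
  shows "0 < phi n x" "phi (Suc n) x < phi n x"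
proof -
  interpret thrice_differentiable_kernel "\<lambda>t. exp (- x * t)" "\<lambda>t. - x * exp (- x * t)"
    "\<lambda>t. x\<^sup>2 * exp (- x * t)" "\<lambda>t. - (x ^ 3) * exp (- x * t)"
  proof
    fix s t :: real assume "s \<le> t"
    then have "exp (- x * t) \<le> exp (- x * s)" using x by simp
    then show "- (x ^ 3) * exp (- x * s) \<le> - (x ^ 3) * exp (- x * t)"
      using x by (intro mult_left_mono_neg) auto
  qed (use x in \<open>auto intro!: derivative_eq_intros simp: power2_eq_square power3_eq_cube\<close>)
  \<comment> \<open>This is exactly minus the derivative of the exponential kernel at 2.\<close>
  define A where "A = x * exp (- x * 2)"
  have "0 < A" using x by (simp add: A_def)
  then have "0 < A * (4 / (4 * (real n)\<^sup>2 - 1))"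
    "0 < A * (4 / (4 * (real n)\<^sup>2 - 1) - 4 / (4 * (real (Suc n))\<^sup>2 - 1))"
    using linear_coeff_pos[OF n] by simp_all
  with sine_coeff_bounds[OF n, of A] show "0 < phi n x" "phi (Suc n) x < phi n x"
    unfolding phi_eq_sine_coeff A_def by simp_all
qed

section \<open>Kernels singular at the origin\<close>

text \<open>A crude form of Jordan's inequality: up to pi/6 the cosine is at least 1/2, and
  afterwards sin x >= 1/2 >= x/4. It compares K(2 sin theta) with K(theta/2), and arcs with
  chords.\<close>

lemma sin_ge_quarter:
  fixes x :: real
  assumes "0 \<le> x" "x \<le> pi / 2"
  shows "x / 4 \<le> sin x"
proof (cases "x \<le> pi / 6")
  case True
  have "(\<lambda>y. sin y - y / 4) 0 \<le> (\<lambda>y. sin y - y / 4) x"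
  proof (rule DERIV_nonneg_imp_nondecreasing[OF assms(1)])
    fix z :: real assume z: "0 \<le> z" "z \<le> x"
    have "cos (pi / 3) \<le> cos z"
      using z True by (intro cos_monotone_0_pi_le) auto
    then show "\<exists>l. ((\<lambda>y. sin y - y / 4) has_real_derivative l) (at z) \<and> 0 \<le> l"
      by (intro exI[of _ "cos z - 1 / 4"]) (auto intro!: derivative_eq_intros simp: cos_60)
  qed
  then show ?thesis by simp
next
  case False
  have "x / 4 \<le> 1 / 2" using assms pi_less_4 by linarith
  also have "\<dots> = sin (pi / 6)" by (simp add: sin_30)
  also have "\<dots> \<le> sin x" using False assms by (intro sin_monotone_2pi_le) auto
  finally show ?thesis .
qed

locale singular_kernel =
  fixes K :: "real \<Rightarrow> real"
  assumes smooth: "smooth_pos K"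
    and cm: "completely_monotone (\<lambda>t. - deriv K t)"
    and nontrivial: "\<exists>t>0. - deriv K t \<noteq> 0"
    and integrable_near_0: "set_integrable lborel {0<..<1} K"
begin

lemma deriv_neg: "0 < t \<Longrightarrow> deriv K t < 0"
  using completely_monotone_pos[OF cm, of _ t] nontrivial by auto

lemma has_deriv: "0 < t \<Longrightarrow> (K has_real_derivative deriv K t) (at t)"
  using smooth_posD[OF smooth, of t 0] by simp

lemma antimono:
  assumes "0 < s" "s \<le> t"
  shows "K t \<le> K s"
proof (rule DERIV_nonpos_imp_nonincreasing[OF assms(2)])
  fix x assume "s \<le> x"
  with assms have "0 < x" by linarith
  with has_deriv deriv_neg show "\<exists>y. (K has_real_derivative y) (at x) \<and> y \<le> 0"
    by (meson less_imp_le)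
qed

lemma isCont: "0 < t \<Longrightarrow> isCont K t"
  using DERIV_isCont has_deriv by blast

lemma isCont_sin: "0 < \<theta> \<Longrightarrow> \<theta> < pi \<Longrightarrow> isCont (\<lambda>\<theta>. K (2 * sin \<theta>)) \<theta>"
  by (rule isCont_o2[OF _ isCont]) (auto intro!: sin_gt_zero continuous_intros)

lemma integrable_to_2: "set_integrable lborel {0<..<2} K"
proof (rule set_integrable_subset)
  show "set_integrable lborel ({0<..<1} \<union> {1..2}) K"
    by (intro set_integrable_Un integrable_near_0 borel_integrable_atLeastAtMost'
        continuous_at_imp_continuous_on) (auto intro: isCont)
qed auto

text \<open>An integrable majorant: \<open>K\<close> is antitone, and 2 sin \<theta> lies between
  half the distance from \<theta> to the nearer endpoint and 2.\<close>

lemma abs_sin_le: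
  assumes "0 < \<theta>" "\<theta> < pi"
  shows "\<bar>K (2 * sin \<theta>)\<bar> \<le> \<bar>K 2\<bar> + \<bar>K (\<theta> / 2)\<bar> + \<bar>K ((pi - \<theta>) / 2)\<bar>"
proof -
  have "K (2 * sin \<theta>) \<le> \<bar>K (\<theta> / 2)\<bar> + \<bar>K ((pi - \<theta>) / 2)\<bar>"
  proof (cases "\<theta> \<le> pi / 2")
    case True
    then have "K (2 * sin \<theta>) \<le> K (\<theta> / 2)"
      using sin_ge_quarter[of \<theta>] assms by (intro antimono) auto
    then show ?thesis by linarith
  next
    case False
    then have "K (2 * sin \<theta>) \<le> K ((pi - \<theta>) / 2)"
      using sin_ge_quarter[of "pi - \<theta>"] assms by (intro antimono) auto
    then show ?thesis by linarith
  qed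
  moreover have "K 2 \<le> K (2 * sin \<theta>)"
    using assms by (intro antimono) (auto intro: sin_gt_zero)
  ultimately show ?thesis by linarith
qed

lemma integrable_sin: "set_integrable lborel {0..pi} (\<lambda>\<theta>. K (2 * sin \<theta>))"
proof -
  have "set_integrable lborel {0<..<pi} (\<lambda>\<theta>. \<bar>K 2\<bar> + \<bar>K (\<theta> / 2)\<bar> + \<bar>K ((pi - \<theta>) / 2)\<bar>)"
  proof (intro set_integral_add set_integrable_abs)
    show "set_integrable lborel {0<..<pi} (\<lambda>\<theta>. K 2)"
      by (rule set_integrable_subset[of _ "{0..pi}"]) (auto intro!: borel_integrable_atLeastAtMost')
    show "set_integrable lborel {0<..<pi} (\<lambda>\<theta>. K (\<theta> / 2))"
      by (rule set_integrable_subset[where A = "{x. 0 + 1 / 2 * x \<in> {0<..<2}}"])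
        (use set_integrable_real_affine[OF integrable_to_2, of "1 / 2" 0] pi_less_4 in auto)
    show "set_integrable lborel {0<..<pi} (\<lambda>\<theta>. K ((pi - \<theta>) / 2))"
      by (rule set_integrable_subset[where A = "{x. pi / 2 + (- 1 / 2) * x \<in> {0<..<2}}"])
        (use set_integrable_real_affine[OF integrable_to_2, of "- 1 / 2" "pi / 2"] pi_less_4
          in \<open>auto simp: diff_divide_distrib\<close>)
  qed
  then have "set_integrable lborel {0<..<pi} (\<lambda>\<theta>. K (2 * sin \<theta>))"
  proof (rule set_integrable_bound)
    show "set_borel_measurable lborel {0<..<pi} (\<lambda>\<theta>. K (2 * sin \<theta>))"
      unfolding set_borel_measurable_def
      using borel_measurable_continuous_on_indicator[of "{0<..<pi}" "\<lambda>\<theta>. K (2 * sin \<theta>)"]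
        continuous_at_imp_continuous_on[of "{0<..<pi}" "\<lambda>\<theta>. K (2 * sin \<theta>)"] isCont_sin by simp
  qed (use abs_sin_le in \<open>auto intro!: AE_I2\<close>)
  \<comment> \<open>At the endpoints \<open>K\<close> is evaluated at 0, where nothing is known
    about it; two points form a null set.\<close>
  then show ?thesis
    by (subst set_integrable_discrete_difference[where B = "{0<..<pi}" and X = "{0, pi}"]) auto
qed

text \<open>Dominated convergence. The shifted argument lies between 2 sin \<theta> and 3, so by
  monotonicity the shifted kernel is bounded by |K(2 sin \<theta>)| + |K(3)|. The endpoints, where
  the argument of \<open>K\<close> is 0, are excluded almost everywhere.\<close>

lemma sine_coeff_shift_tendsto:
  assumes "\<epsilon> \<longlonglongrightarrow> 0" "\<And>m. 0 < \<epsilon> m" "\<And>m. \<epsilon> m \<le> 1"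
  shows "(\<lambda>m. sine_coeff (\<lambda>t. K (t + \<epsilon> m)) n) \<longlonglongrightarrow> sine_coeff K n"
  unfolding sine_coeff_def set_lebesgue_integral_def
proof (rule integral_dominated_convergence)
  let ?C = "\<lambda>\<theta>. cos (2 * real n * \<theta>)"
  let ?w = "\<lambda>\<theta>. indicat_real {0..pi} \<theta> *\<^sub>R (\<bar>K (2 * sin \<theta>)\<bar> + \<bar>K 3\<bar>)"
  have meas: "(\<lambda>\<theta>. indicat_real {0..pi} \<theta> *\<^sub>R f \<theta>) \<in> borel_measurable lborel"
    if "set_integrable lborel {0..pi} f" for f :: "real \<Rightarrow> real"
    using that unfolding set_integrable_def by (rule borel_measurable_integrable)
  have "(\<lambda>\<theta>. (indicat_real {0..pi} \<theta> *\<^sub>R K (2 * sin \<theta>)) * ?C \<theta>) \<in> borel_measurable lborel"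
    by (intro borel_measurable_times meas integrable_sin) simp
  then show "(\<lambda>\<theta>. indicat_real {0..pi} \<theta> *\<^sub>R (K (2 * sin \<theta>) * ?C \<theta>)) \<in> borel_measurable lborel"
    by (simp add: mult.assoc)
  show "(\<lambda>\<theta>. indicat_real {0..pi} \<theta> *\<^sub>R (K (2 * sin \<theta> + \<epsilon> m) * ?C \<theta>)) \<in> borel_measurable lborel" for m
  proof (rule meas[OF borel_integrable_atLeastAtMost'], intro continuous_at_imp_continuous_on ballI
      continuous_intros)
    fix \<theta> assume "\<theta> \<in> {0..pi}"
    then show "isCont (\<lambda>\<theta>. K (2 * sin \<theta> + \<epsilon> m)) \<theta>"
      using assms(2)[of m]
      by (intro isCont_o2[OF _ isCont]) (auto intro!: add_nonneg_pos sin_ge_zero continuous_intros)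
  qed
  have "set_integrable lborel {0..pi} (\<lambda>\<theta>. \<bar>K (2 * sin \<theta>)\<bar> + \<bar>K 3\<bar>)"
    by (intro set_integral_add set_integrable_abs integrable_sin borel_integrable_atLeastAtMost') simp
  then show "integrable lborel ?w" by (simp add: set_integrable_def)
  have AE: "AE \<theta> in lborel. \<theta> \<noteq> 0 \<and> \<theta> \<noteq> pi"
    using AE_lborel_singleton[of 0] AE_lborel_singleton[of pi] by eventually_elim auto
  show "AE \<theta> in lborel. (\<lambda>m. indicat_real {0..pi} \<theta> *\<^sub>R (K (2 * sin \<theta> + \<epsilon> m) * ?C \<theta>))
      \<longlonglongrightarrow> indicat_real {0..pi} \<theta> *\<^sub>R (K (2 * sin \<theta>) * ?C \<theta>)"
    using AE
  proof eventually_elim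
    case (elim \<theta>)
    show ?case
    proof (cases "\<theta> \<in> {0..pi}")
      case True
      then have "isCont K (2 * sin \<theta>)" using elim by (intro isCont) (auto intro!: sin_gt_zero)
      moreover have "(\<lambda>m. 2 * sin \<theta> + \<epsilon> m) \<longlonglongrightarrow> 2 * sin \<theta> + 0"
        by (intro tendsto_intros assms)
      ultimately have "(\<lambda>m. K (2 * sin \<theta> + \<epsilon> m)) \<longlonglongrightarrow> K (2 * sin \<theta>)"
        using isCont_tendsto_compose by fastforce
      then show ?thesis by (intro tendsto_intros)
    qed simp
  qed
  show "AE \<theta> in lborel. norm (indicat_real {0..pi} \<theta> *\<^sub>R (K (2 * sin \<theta> + \<epsilon> m) * ?C \<theta>)) \<le> ?w \<theta>" for m
    using AE
  proof eventually_elim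
    case (elim \<theta>)
    show ?case
    proof (cases "\<theta> \<in> {0..pi}")
      case True
      then have "0 < sin \<theta>" using elim by (intro sin_gt_zero) auto
      moreover have "sin \<theta> \<le> 1" by simp
      ultimately have "K (2 * sin \<theta> + \<epsilon> m) \<le> K (2 * sin \<theta>)" "K 3 \<le> K (2 * sin \<theta> + \<epsilon> m)"
        using assms(2,3)[of m] by (intro antimono; linarith)+
      then have "\<bar>K (2 * sin \<theta> + \<epsilon> m)\<bar> \<le> \<bar>K (2 * sin \<theta>)\<bar> + \<bar>K 3\<bar>" by linarith
      moreover have "\<bar>K (2 * sin \<theta> + \<epsilon> m)\<bar> * \<bar>?C \<theta>\<bar> \<le> \<bar>K (2 * sin \<theta> + \<epsilon> m)\<bar> * 1"
        by (intro mult_left_mono) auto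
      ultimately show ?thesis using True by (simp add: abs_mult)
    qed simp
  qed
qed

text \<open>The shift moves [0, 2] away from the singularity. The derivatives are written through
  \<open>- deriv K\<close>, so that complete monotonicity supplies their signs directly.\<close>

lemma shift_thrice_differentiable:
  assumes "0 < \<epsilon>"
  shows "thrice_differentiable_kernel (\<lambda>t. K (t + \<epsilon>)) (\<lambda>t. deriv K (t + \<epsilon>))
    (\<lambda>t. - deriv (\<lambda>t. - deriv K t) (t + \<epsilon>)) (\<lambda>t. - deriv (deriv (\<lambda>t. - deriv K t)) (t + \<epsilon>))"
proof
  let ?g = "\<lambda>t. - deriv K t"
  have shift: "((\<lambda>t. f (t + \<epsilon>)) has_real_derivative D) (at t)"
    if "(f has_real_derivative D) (at (t + \<epsilon>))" for f D t
    using that by (simp add: DERIV_shift)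
  have g: "((deriv ^^ k) ?g has_real_derivative (deriv ^^ Suc k) ?g t) (at t)" if "0 < t" for k t
    using smooth_posD[OF completely_monotone_imp_smooth_pos[OF cm] that] .
  fix s t :: real assume t: "0 \<le> t"
  then have pos: "0 < t + \<epsilon>" using assms by simp
  show "((\<lambda>t. K (t + \<epsilon>)) has_real_derivative deriv K (t + \<epsilon>)) (at t)"
    by (intro shift has_deriv pos)
  show "((\<lambda>t. deriv K (t + \<epsilon>)) has_real_derivative - deriv ?g (t + \<epsilon>)) (at t)"
    using DERIV_minus[OF g[OF pos, of 0]] by (intro shift) simp
  show "((\<lambda>t. - deriv ?g (t + \<epsilon>)) has_real_derivative - deriv (deriv ?g) (t + \<epsilon>)) (at t)"
    using DERIV_minus[OF g[OF pos, of 1]] by (intro shift) simp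
  show "- deriv (deriv ?g) (t + \<epsilon>) \<le> 0"
    using completely_monotoneD[OF cm pos, of 2] by (simp add: numeral_2_eq_2)
next
  fix s t :: real assume "0 \<le> s" "s \<le> t"
  then show "- deriv (deriv (\<lambda>t. - deriv K t)) (s + \<epsilon>) \<le> - deriv (deriv (\<lambda>t. - deriv K t)) (t + \<epsilon>)"
    using completely_monotone_antimono[OF cm, of "s + \<epsilon>" "t + \<epsilon>" 2] assms by (simp add: numeral_2_eq_2)
qed

text \<open>The bounds for the shifted kernels hold with a margin independent of the shift and pass
  to the limit; a positive margin makes the limiting inequalities strict.\<close>

lemma lam_bounds:
  assumes n: "1 \<le> n"
  shows "0 < lam K n" "lam K (Suc n) < lam K n"
proof -
  \<comment> \<open>The shifts are at most 1, so 2 plus a shift is at most 3; since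
    \<open>- deriv K\<close> is antitone, its value at 3 bounds all the values that occur from
    below.\<close>
  define A where "A = - deriv K 3"
  define \<epsilon> where "\<epsilon> m = 1 / real (Suc m)" for m
  let ?a = "4 / (4 * (real n)\<^sup>2 - 1)"
  let ?d = "?a - 4 / (4 * (real (Suc n))\<^sup>2 - 1)"
  have \<epsilon>: "\<epsilon> \<longlonglongrightarrow> 0" "0 < \<epsilon> m" "\<epsilon> m \<le> 1" for m
    using LIMSEQ_inverse_real_of_nat by (auto simp: \<epsilon>_def[abs_def] inverse_eq_divide)
  have bounds: "A * ?a \<le> sine_coeff (\<lambda>t. K (t + \<epsilon> m)) n"
    "A * ?d \<le> sine_coeff (\<lambda>t. K (t + \<epsilon> m)) n - sine_coeff (\<lambda>t. K (t + \<epsilon> m)) (Suc n)" for m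
  proof -
    interpret thrice_differentiable_kernel "\<lambda>t. K (t + \<epsilon> m)" "\<lambda>t. deriv K (t + \<epsilon> m)"
      "\<lambda>t. - deriv (\<lambda>t. - deriv K t) (t + \<epsilon> m)" "\<lambda>t. - deriv (deriv (\<lambda>t. - deriv K t)) (t + \<epsilon> m)"
      by (rule shift_thrice_differentiable[OF \<epsilon>(2)])
    have "A \<le> - deriv K (2 + \<epsilon> m)"
      using completely_monotone_antimono[OF cm, of "2 + \<epsilon> m" 3 0] \<epsilon>(2,3)[of m] by (simp add: A_def)
    moreover have "0 \<le> - deriv (\<lambda>t. - deriv K t) (2 + \<epsilon> m)"
      using completely_monotoneD[OF cm, of "2 + \<epsilon> m" 1] \<epsilon>(2)[of m] by simp
    ultimately show "A * ?a \<le> sine_coeff (\<lambda>t. K (t + \<epsilon> m)) n"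
      "A * ?d \<le> sine_coeff (\<lambda>t. K (t + \<epsilon> m)) n - sine_coeff (\<lambda>t. K (t + \<epsilon> m)) (Suc n)"
      using sine_coeff_bounds[OF n] by blast+
  qed
  note lim = sine_coeff_shift_tendsto[OF \<epsilon>]
  have A: "0 < A" using deriv_neg[of 3] by (simp add: A_def)
  have "A * ?a \<le> sine_coeff K n"
    by (rule LIMSEQ_le_const[OF lim]) (use bounds(1) in blast)
  moreover have "0 < A * ?a" using A linear_coeff_pos(1)[OF n] by (rule mult_pos_pos)
  ultimately show "0 < lam K n" by (simp add: lam_eq_sine_coeff)
  have "A * ?d \<le> sine_coeff K n - sine_coeff K (Suc n)"
    by (rule LIMSEQ_le_const[OF tendsto_diff[OF lim lim]]) (use bounds(2) in blast)
  moreover have "0 < A * ?d" using A linear_coeff_pos(2)[OF n] by (rule mult_pos_pos)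
  ultimately show "lam K (Suc n) < lam K n" by (simp add: lam_eq_sine_coeff)
qed

end

section \<open>Hoelder functions on the circle\<close>

lemma dist_cis: "dist (cis s) (cis t) = 2 * \<bar>sin ((s - t) / 2)\<bar>"
proof -
  have "cis s - cis t = cis t * (cis (s - t) - 1)"
    by (simp add: algebra_simps cis_mult)
  then have "dist (cis s) (cis t) = norm (cis (s - t) - 1)"
    by (simp add: dist_norm norm_mult)
  then show ?thesis using dist_exp_i_1[of "s - t"] by (simp add: cis_conv_exp)
qed

lemma dist_cis_le: "dist (cis s) (cis t) \<le> \<bar>s - t\<bar>"
  using abs_sin_x_le_abs_x[of "(s - t) / 2"] by (simp add: dist_cis)

lemma dist_cis_le_2: "dist (cis s) (cis t) \<le> 2"
  by (simp add: dist_cis)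

lemma dist_cis_diff: "dist (cis (s - u)) (cis (t - u)) = dist (cis s) (cis t)"
  by (simp add: dist_cis)

lemma dist_cis_powr_le:
  assumes "0 < \<alpha>"
  shows "dist (cis s) (cis t) powr \<alpha> \<le> 2 powr \<alpha>" "dist (cis s) (cis t) powr \<alpha> \<le> \<bar>s - t\<bar> powr \<alpha>"
  using assms dist_cis_le dist_cis_le_2 by (auto intro!: powr_mono2)

text \<open>Half the chord lies in [0, 1], where d <= d^\<alpha>. This turns Lipschitz bounds into
  Hoelder bounds.\<close>

lemma dist_cis_le_powr:
  assumes "0 < \<alpha>" "\<alpha> \<le> 1"
  shows "dist (cis s) (cis t) \<le> 2 * dist (cis s) (cis t) powr \<alpha>"
proof -
  define d where "d = dist (cis s) (cis t) / 2"
  have d: "0 \<le> d" "d \<le> 1" using dist_cis_le_2[of s t] by (auto simp: d_def)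
  have "d powr 1 \<le> d powr \<alpha>" using d assms by (intro powr_mono') auto
  then have "dist (cis s) (cis t) \<le> 2 * d powr \<alpha>" using d by (simp add: d_def)
  also have "d powr \<alpha> \<le> dist (cis s) (cis t) powr \<alpha>"
    using assms d by (intro powr_mono2) (auto simp: d_def)
  finally show ?thesis by simp
qed

text \<open>Rounding picks the representative of the angle difference in [-pi, pi]. For it,
  \<open>sin_ge_quarter\<close> at half the angle bounds the arc by four times the chord.\<close>

lemma arc_length_le_dist_cis:
  obtains m :: int where "\<bar>s - (t + of_int m * (2 * pi))\<bar> \<le> 4 * dist (cis s) (cis t)"
proof
  define m where "m = round ((s - t) / (2 * pi))"
  define u where "u = s - (t + of_int m * (2 * pi))"
  have "\<bar>of_int m - (s - t) / (2 * pi)\<bar> * (2 * pi) \<le> 1 / 2 * (2 * pi)"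
    unfolding m_def by (intro mult_right_mono of_int_round_abs_le) auto
  moreover have "\<bar>of_int m - (s - t) / (2 * pi)\<bar> * (2 * pi) = \<bar>u\<bar>"
  proof -
    have "\<bar>of_int m - (s - t) / (2 * pi)\<bar> * (2 * pi) = \<bar>(of_int m - (s - t) / (2 * pi)) * (2 * pi)\<bar>"
      by (simp add: abs_mult)
    also have "(of_int m - (s - t) / (2 * pi)) * (2 * pi) = - u"
      by (simp add: u_def field_simps)
    finally show ?thesis by simp
  qed
  ultimately have u: "\<bar>u\<bar> \<le> pi" by simp
  have "cis (t + of_int m * (2 * pi)) = cis t"
    using sin.plus_of_int[of t m] cos.plus_of_int[of t m] by (simp add: complex_eq_iff)
  then have "dist (cis s) (cis t) = 2 * \<bar>sin (u / 2)\<bar>"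
    using dist_cis[of s "t + of_int m * (2 * pi)"] by (simp add: u_def)
  also have "\<bar>sin (u / 2)\<bar> = sin (\<bar>u\<bar> / 2)"
    using u sin_ge_zero[of "\<bar>u\<bar> / 2"] by (cases "0 \<le> u") auto
  finally have "dist (cis s) (cis t) = 2 * sin (\<bar>u\<bar> / 2)" .
  with sin_ge_quarter[of "\<bar>u\<bar> / 2"] u
  show "\<bar>s - (t + of_int m * (2 * pi))\<bar> \<le> 4 * dist (cis s) (cis t)" by (simp add: u_def)
qed

text \<open>Functions on the circle are handled through the angle. Measuring by chords forces 2 pi
  periodicity, because \<open>0 powr \<alpha> = 0\<close>.\<close>

definition circle_Holder :: "real \<Rightarrow> (real \<Rightarrow> 'a::real_normed_vector) \<Rightarrow> bool" where
  "circle_Holder \<alpha> f \<longleftrightarrow> (\<exists>C. \<forall>s t. norm (f s - f t) \<le> C * dist (cis s) (cis t) powr \<alpha>)"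

lemma circle_HolderE:
  assumes "circle_Holder \<alpha> f"
  obtains C where "0 \<le> C" "\<And>s t. norm (f s - f t) \<le> C * dist (cis s) (cis t) powr \<alpha>"
proof -
  obtain C where C: "norm (f s - f t) \<le> C * dist (cis s) (cis t) powr \<alpha>" for s t
    using assms by (auto simp: circle_Holder_def)
  have "norm (f s - f t) \<le> \<bar>C\<bar> * dist (cis s) (cis t) powr \<alpha>" for s t
    by (rule order_trans[OF C]) (auto intro: mult_right_mono)
  then show thesis using that[of "\<bar>C\<bar>"] by auto
qed

lemma circle_Holder_bounded:
  assumes "0 < \<alpha>" "circle_Holder \<alpha> f"
  obtains B where "0 \<le> B" "\<And>t. norm (f t) \<le> B"
proof -
  obtain C where C: "0 \<le> C" "\<And>s t. norm (f s - f t) \<le> C * dist (cis s) (cis t) powr \<alpha>"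
    using circle_HolderE[OF assms(2)] by metis
  have "norm (f t) \<le> norm (f 0) + C * 2 powr \<alpha>" for t
  proof -
    have "norm (f t - f 0) \<le> C * 2 powr \<alpha>"
      by (rule order_trans[OF C(2)]) (intro mult_left_mono dist_cis_powr_le assms C(1))
    then show ?thesis using norm_triangle_ineq2[of "f t" "f 0"] by linarith
  qed
  then show thesis using that[of "norm (f 0) + C * 2 powr \<alpha>"] C(1) by simp
qed

lemma circle_Holder_continuous:
  assumes "0 < \<alpha>" "circle_Holder \<alpha> f"
  shows "isCont f t"
proof -
  obtain C where C: "0 \<le> C" "\<And>s t. norm (f s - f t) \<le> C * dist (cis s) (cis t) powr \<alpha>"
    using circle_HolderE[OF assms(2)] by metis
  have "((\<lambda>s. C * \<bar>s - t\<bar> powr \<alpha>) \<longlongrightarrow> C * \<bar>t - t\<bar> powr \<alpha>) (at t)"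
    using assms(1) by (intro tendsto_intros tendsto_powr') auto
  then have lim: "((\<lambda>s. C * \<bar>s - t\<bar> powr \<alpha>) \<longlongrightarrow> 0) (at t)" using assms(1) by simp
  have "((\<lambda>s. f s - f t) \<longlongrightarrow> 0) (at t)"
  proof (rule Lim_null_comparison[OF _ lim])
    have "norm (f s - f t) \<le> C * \<bar>s - t\<bar> powr \<alpha>" for s
      by (rule order_trans[OF C(2)]) (intro mult_left_mono dist_cis_powr_le assms C(1))
    then show "\<forall>\<^sub>F s in at t. norm (f s - f t) \<le> C * \<bar>s - t\<bar> powr \<alpha>" by simp
  qed
  then show ?thesis by (simp add: isCont_def LIM_zero_iff)
qed

section \<open>Closure properties of Hoelder functions on the circle\<close>

lemma circle_Holder_add:
  assumes "circle_Holder \<alpha> f" "circle_Holder \<alpha> g"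
  shows "circle_Holder \<alpha> (\<lambda>t. f t + g t)"
proof -
  obtain C where C: "\<And>s t. norm (f s - f t) \<le> C * dist (cis s) (cis t) powr \<alpha>"
    using circle_HolderE[OF assms(1)] by metis
  obtain D where D: "\<And>s t. norm (g s - g t) \<le> D * dist (cis s) (cis t) powr \<alpha>"
    using circle_HolderE[OF assms(2)] by metis
  have "norm (f s + g s - (f t + g t)) \<le> (C + D) * dist (cis s) (cis t) powr \<alpha>" for s t
    using norm_triangle_ineq[of "f s - f t" "g s - g t"] C[of s t] D[of s t]
    by (simp add: algebra_simps)
  then show ?thesis by (auto simp: circle_Holder_def)
qed

lemma circle_Holder_bounded_linear:
  assumes "circle_Holder \<alpha> f" "bounded_linear T"
  shows "circle_Holder \<alpha> (\<lambda>t. T (f t))"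
proof -
  obtain C where C: "\<And>s t. norm (f s - f t) \<le> C * dist (cis s) (cis t) powr \<alpha>"
    using circle_HolderE[OF assms(1)] by metis
  interpret bounded_linear T by fact
  obtain B where B: "0 \<le> B" "\<And>x. norm (T x) \<le> norm x * B" using nonneg_bounded by blast
  have "norm (T (f s) - T (f t)) \<le> (C * B) * dist (cis s) (cis t) powr \<alpha>" for s t
  proof -
    have "norm (T (f s) - T (f t)) \<le> norm (f s - f t) * B" using B(2)[of "f s - f t"] by (simp add: diff)
    also have "\<dots> \<le> (C * dist (cis s) (cis t) powr \<alpha>) * B" by (intro mult_right_mono C B)
    finally show ?thesis by (simp add: mult_ac)
  qed
  then show ?thesis by (auto simp: circle_Holder_def)
qed

lemma circle_Holder_mult:
  fixes f g :: "real \<Rightarrow> 'a::real_normed_algebra"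
  assumes \<alpha>: "0 < \<alpha>" and f: "circle_Holder \<alpha> f" and g: "circle_Holder \<alpha> g"
  shows "circle_Holder \<alpha> (\<lambda>t. f t * g t)"
proof -
  obtain C where C: "\<And>s t. norm (f s - f t) \<le> C * dist (cis s) (cis t) powr \<alpha>"
    using circle_HolderE[OF f] by metis
  obtain D where D: "\<And>s t. norm (g s - g t) \<le> D * dist (cis s) (cis t) powr \<alpha>"
    using circle_HolderE[OF g] by metis
  obtain A where A: "0 \<le> A" "\<And>t. norm (f t) \<le> A" using circle_Holder_bounded[OF \<alpha> f] by metis
  obtain B where B: "0 \<le> B" "\<And>t. norm (g t) \<le> B" using circle_Holder_bounded[OF \<alpha> g] by metis
  have "norm (f s * g s - f t * g t) \<le> (A * D + C * B) * dist (cis s) (cis t) powr \<alpha>" for s t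
  proof -
    let ?d = "dist (cis s) (cis t) powr \<alpha>"
    have "f s * g s - f t * g t = f s * (g s - g t) + (f s - f t) * g t" by (simp add: algebra_simps)
    also have "norm \<dots> \<le> norm (f s) * norm (g s - g t) + norm (f s - f t) * norm (g t)"
      by (intro order_trans[OF norm_triangle_ineq] add_mono norm_mult_ineq)
    also have "\<dots> \<le> A * (D * ?d) + (C * ?d) * B"
      using order_trans[OF norm_ge_zero C[of s t]]
      by (intro add_mono mult_mono A B C D) auto
    finally show ?thesis by (simp add: algebra_simps)
  qed
  then show ?thesis by (auto simp: circle_Holder_def)
qed

lemma circle_Holder_Lipschitz:
  assumes \<alpha>: "0 < \<alpha>" "\<alpha> \<le> 1" and L: "0 \<le> L" "\<And>s t. norm (f s - f t) \<le> L * dist (cis s) (cis t)"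
  shows "circle_Holder \<alpha> f"
proof -
  have "norm (f s - f t) \<le> (L * 2) * dist (cis s) (cis t) powr \<alpha>" for s t
    using order_trans[OF L(2)[of s t] mult_left_mono[OF dist_cis_le_powr[OF \<alpha>] L(1)]]
    by (simp add: mult_ac)
  then show ?thesis by (auto simp: circle_Holder_def)
qed

lemma circle_Holder_cis:
  assumes "0 < \<alpha>" "\<alpha> \<le> 1"
  shows "circle_Holder \<alpha> cis"
  by (rule circle_Holder_Lipschitz[OF assms, of 1]) (auto simp: dist_norm)

text \<open>The bounded derivative gives a Lipschitz estimate in the angle. Moving one angle by a
  multiple of 2 pi makes the arc comparable to the chord, and Lipschitz implies Hoelder.\<close>

lemma circle_Holder_of_deriv:
  fixes h :: "complex \<Rightarrow> 'a::real_normed_vector"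
  assumes \<alpha>: "0 < \<alpha>" "\<alpha> \<le> 1"
    and deriv: "\<And>t. ((\<lambda>t. h (cis t)) has_vector_derivative f' t) (at t)"
    and f': "circle_Holder \<alpha> f'"
  shows "circle_Holder \<alpha> (\<lambda>t. h (cis t))"
proof -
  obtain M where M: "0 \<le> M" "\<And>t. norm (f' t) \<le> M" using circle_Holder_bounded[OF \<alpha>(1) f'] by metis
  have lip: "norm (h (cis s) - h (cis t)) \<le> M * \<bar>s - t\<bar>" for s t
    using differentiable_bound[of UNIV "\<lambda>t. h (cis t)" "\<lambda>t x. x *\<^sub>R f' t" M s t] deriv M
    by (auto simp: has_vector_derivative_def onorm_scaleR_left bounded_linear_ident onorm_id)
  show ?thesis
  proof (rule circle_Holder_Lipschitz[OF \<alpha>])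
    show "0 \<le> M * 4" using M by simp
    fix s t
    obtain m where m: "\<bar>s - (t + of_int m * (2 * pi))\<bar> \<le> 4 * dist (cis s) (cis t)"
      by (rule arc_length_le_dist_cis)
    have "cis (t + of_int m * (2 * pi)) = cis t"
      using sin.plus_of_int[of t m] cos.plus_of_int[of t m] by (simp add: complex_eq_iff)
    then have "norm (h (cis s) - h (cis t)) \<le> M * \<bar>s - (t + of_int m * (2 * pi))\<bar>"
      using lip[of s "t + of_int m * (2 * pi)"] by simp
    also have "\<dots> \<le> M * (4 * dist (cis s) (cis t))" by (intro mult_left_mono m M)
    finally show "norm (h (cis s) - h (cis t)) \<le> M * 4 * dist (cis s) (cis t)" by simp
  qed
qed

lemma C1_Holder_circle_iff:
  "f \<in> C1_Holder_circle \<alpha> \<longleftrightarrow> (\<forall>w. w \<notin> circle \<longrightarrow> f w = 0) \<and>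
    (\<exists>f'. (\<forall>t. ((\<lambda>t. f (cis t)) has_vector_derivative f' t) (at t)) \<and> circle_Holder \<alpha> f')"
  by (simp add: C1_Holder_circle_def circle_Holder_def)

text \<open>Translation reduces \<open>a\<close> modulo \<open>P\<close> to some \<open>r\<close> in
  [0, P]. The interval [r, r + P] is then cut at \<open>P\<close> and its right part is moved back
  to [0, r].\<close>

lemma periodic_set_integral_shift:
  fixes q :: "real \<Rightarrow> real"
  assumes per: "\<And>x. q (x + P) = q x" and P: "0 < P" and int: "set_integrable lborel {0..P} q"
  shows "(LINT x:{a..a + P}|lborel. q x) = (LINT x:{0..P}|lborel. q x)"
proof -
  interpret q: periodic_fun_simple q P by unfold_locales (rule per)
  define m where "m = \<lfloor>a / P\<rfloor>"
  define r where "r = a - of_int m * P"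
  have "of_int m \<le> a / P" "a / P < of_int m + 1" unfolding m_def by linarith+
  then have r: "0 \<le> r" "r \<le> P" using P by (auto simp: r_def field_simps)
  have sets: "{x. of_int m * P + 1 * x \<in> {a..a + P}} = {r..r + P}"
    "{x. P + 1 * x \<in> {P..r + P}} = {0..r}" by (auto simp: r_def)
  have "q (of_int m * P + x) = q x" for x
    using q.plus_of_int[of x m] by (simp add: add.commute)
  then have "(LINT x:{a..a + P}|lborel. q x) = (LINT x:{r..r + P}|lborel. q x)"
    using set_integral_real_affine[of 1 "{a..a + P}" q "of_int m * P"] unfolding sets by simp
  also have "\<dots> = (LINT x:{r..P} \<union> {P..r + P}|lborel. q x)"
    by (rule arg_cong[where f = "\<lambda>A. LINT x:A|lborel. q x"]) (use r in auto)
  also have "\<dots> = (LINT x:{r..P}|lborel. q x) + (LINT x:{P..r + P}|lborel. q x)"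
  proof (rule set_integral_Un_AE)
    show "AE x in lborel. \<not> (x \<in> {r..P} \<and> x \<in> {P..r + P})"
      by (rule AE_mp[OF AE_lborel_singleton[of P]]) auto
    show "set_integrable lborel {r..P} q"
      by (rule set_integrable_subset[OF int]) (use r in auto)
    have "set_integrable lborel {0..r} q"
      by (rule set_integrable_subset[OF int]) (use r in auto)
    then have "set_integrable lborel {x. - P + 1 * x \<in> {0..r}} (\<lambda>x. q (- P + 1 * x))"
      by (rule set_integrable_real_affine) simp
    moreover have "{x. - P + 1 * x \<in> {0..r}} = {P..r + P}" by auto
    moreover have "q (- P + 1 * x) = q x" for x using per[of "x - P"] by simp
    ultimately show "set_integrable lborel {P..r + P} q" by simp
  qed auto
  also have "(LINT x:{P..r + P}|lborel. q x) = (LINT x:{0..r}|lborel. q x)"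
    using set_integral_real_affine[of 1 "{P..r + P}" q P] per unfolding sets by (simp add: add.commute)
  also have "(LINT x:{r..P}|lborel. q x) + (LINT x:{0..r}|lborel. q x)
      = (LINT x:{r..P} \<union> {0..r}|lborel. q x)"
  proof (rule set_integral_Un_AE[symmetric])
    show "AE x in lborel. \<not> (x \<in> {r..P} \<and> x \<in> {0..r})"
      by (rule AE_mp[OF AE_lborel_singleton[of r]]) auto
  qed (use r in \<open>auto intro!: set_integrable_subset[OF int]\<close>)
  also have "{r..P} \<union> {0..r} = {0..P}" using r by auto
  finally show ?thesis .
qed

section \<open>Convolution on the circle\<close>

locale even_periodic_kernel =
  fixes k :: "real \<Rightarrow> real"
  assumes kernel_integrable: "set_integrable lborel {0..2 * pi} k"
    and kernel_periodic: "k (x + 2 * pi) = k x"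
    and kernel_even: "k (- x) = k x"
begin

text \<open>The kernel carries the integration variable and \<open>F\<close> the translate, so that
  differences and derivatives in \<open>t\<close> fall on \<open>F\<close> and never on the possibly
  singular kernel.\<close>

definition "conv F t = (LINT x:{0..2 * pi}|lborel. k x * F (t - x))"
definition "coef m = (LINT x:{0..2 * pi}|lborel. k x * cos (real m * x))"
definition "mass = (LINT x:{0..2 * pi}|lborel. \<bar>k x\<bar>)"

lemma mass_nonneg: "0 \<le> mass"
  unfolding mass_def set_lebesgue_integral_def by (intro Bochner_Integration.integral_nonneg) simp

lemma mult_integrable:
  assumes "\<And>x. isCont G x"
  shows "set_integrable lborel {0..2 * pi} (\<lambda>x. k x * G x)"
proof -
  have cont: "continuous_on {0..2 * pi} G" using assms continuous_at_imp_continuous_on by blast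
  have "bounded (G ` {0..2 * pi})"
    using compact_imp_bounded[OF compact_continuous_image[OF cont]] by simp
  then obtain B where B: "\<And>x. x \<in> {0..2 * pi} \<Longrightarrow> \<bar>G x\<bar> \<le> B"
    unfolding bounded_iff real_norm_def by blast
  have "set_integrable lborel {0..2 * pi} (\<lambda>x. B * k x)"
    using kernel_integrable by simp
  then show ?thesis
  proof (rule set_integrable_bound)
    have "(\<lambda>x. (indicat_real {0..2 * pi} x *\<^sub>R k x) * (indicat_real {0..2 * pi} x *\<^sub>R G x)) \<in> borel_measurable lborel"
      using kernel_integrable borel_integrable_atLeastAtMost'[OF cont]
      unfolding set_integrable_def by (intro borel_measurable_times borel_measurable_integrable)
    moreover have "(indicat_real {0..2 * pi} x *\<^sub>R k x) * (indicat_real {0..2 * pi} x *\<^sub>R G x)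
        = indicat_real {0..2 * pi} x *\<^sub>R (k x * G x)" for x
      by (simp add: indicator_def)
    ultimately show "set_borel_measurable lborel {0..2 * pi} (\<lambda>x. k x * G x)"
      by (simp only: set_borel_measurable_def)
    have "\<bar>k x * G x\<bar> \<le> \<bar>B * k x\<bar>" if "x \<in> {0..2 * pi}" for x
    proof -
      have "\<bar>G x\<bar> \<le> \<bar>B\<bar>" using B[OF that] by linarith
      then show ?thesis unfolding abs_mult mult.commute[of "\<bar>k x\<bar>"] by (rule mult_right_mono) simp
    qed
    then show "AE x in lborel. x \<in> {0..2 * pi} \<longrightarrow> norm (k x * G x) \<le> norm (B * k x)" by simp
  qed
qed

lemma mult_bound:
  assumes G: "\<And>x. isCont G x" and B: "\<And>x. \<bar>G x\<bar> \<le> B"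
  shows "\<bar>LINT x:{0..2 * pi}|lborel. k x * G x\<bar> \<le> mass * B"
proof -
  have "\<bar>LINT x:{0..2 * pi}|lborel. k x * G x\<bar> \<le> (LINT x:{0..2 * pi}|lborel. \<bar>k x * G x\<bar>)"
    using set_integral_norm_bound[OF mult_integrable[OF G]] by simp
  also have "\<dots> \<le> (LINT x:{0..2 * pi}|lborel. \<bar>k x\<bar> * B)"
  proof (rule set_integral_mono)
    show "set_integrable lborel {0..2 * pi} (\<lambda>x. \<bar>k x * G x\<bar>)"
      by (rule set_integrable_abs[OF mult_integrable[OF G]])
    show "set_integrable lborel {0..2 * pi} (\<lambda>x. \<bar>k x\<bar> * B)"
      by (rule set_integrable_mult_left) (use set_integrable_abs[OF kernel_integrable] in simp)
  qed (use B in \<open>auto intro: mult_left_mono simp: abs_mult\<close>)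
  also have "\<dots> = mass * B" by (simp add: mass_def)
  finally show ?thesis .
qed

lemma isCont_reflect:
  assumes "\<And>x. isCont F x"
  shows "isCont (\<lambda>x. F (t - x)) (x :: real)"
  by (rule isCont_o2[OF _ assms]) (intro continuous_intros)

text \<open>Substituting x = t - \<eta> moves the integral to [t - 2 pi, t]; periodicity brings it
  back to [0, 2 pi].\<close>

lemma conv_eq:
  assumes "\<And>x. isCont F x" "\<And>x. F (x + 2 * pi) = F x"
  shows "(LINT \<eta>:{0..2 * pi}|lborel. k (t - \<eta>) * F \<eta>) = conv F t"
proof -
  let ?q = "\<lambda>x. k x * F (t - x)"
  have sets: "{x. t + (- 1) * x \<in> {0..2 * pi}} = {t - 2 * pi..t - 2 * pi + 2 * pi}" by auto
  have "(LINT \<eta>:{0..2 * pi}|lborel. k (t - \<eta>) * F \<eta>) = (LINT x:{t - 2 * pi..t - 2 * pi + 2 * pi}|lborel. ?q x)"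
    using set_integral_real_affine[of "-1" "{0..2 * pi}" "\<lambda>\<eta>. k (t - \<eta>) * F \<eta>" t] unfolding sets by simp
  also have "\<dots> = (LINT x:{0..2 * pi}|lborel. ?q x)"
  proof (rule periodic_set_integral_shift)
    fix x
    have "F (t - (x + 2 * pi)) = F (t - x)"
      using assms(2)[of "t - (x + 2 * pi)"] by (simp add: algebra_simps)
    then show "?q (x + 2 * pi) = ?q x" by (simp add: kernel_periodic)
    show "set_integrable lborel {0..2 * pi} ?q"
      by (rule mult_integrable[OF isCont_reflect[OF assms(1)]])
  qed simp
  finally show ?thesis by (simp add: conv_def)
qed

text \<open>The reflection of \<open>x\<close> to 2 pi - x preserves the even periodic kernel and
  changes the sign of the sine.\<close>

lemma sin_coef_zero: "(LINT x:{0..2 * pi}|lborel. k x * sin (real m * x)) = 0"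
proof -
  let ?f = "\<lambda>x. k x * sin (real m * x)"
  have sets: "{x. 2 * pi + (- 1) * x \<in> {0..2 * pi}} = {0..2 * pi}" by auto
  have "?f (2 * pi + (- 1) * x) = - ?f x" for x
  proof -
    have "k (2 * pi - x) = k x" using kernel_periodic[of "- x"] kernel_even[of x] by (simp add: add.commute)
    moreover have "real m * (2 * pi - x) = real (2 * m) * pi - real m * x" by (simp add: algebra_simps)
    ultimately show ?thesis by (simp only: mult_minus1 add_uminus_conv_diff sin_diff sin_npi cos_npi) simp
  qed
  then have "(LINT x:{0..2 * pi}|lborel. ?f x) = (LINT x:{0..2 * pi}|lborel. - ?f x)"
    using set_integral_real_affine[of "-1" "{0..2 * pi}" ?f "2 * pi"] unfolding sets by simp
  also have "\<dots> = - (LINT x:{0..2 * pi}|lborel. ?f x)"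
    by (intro set_integral_uminus mult_integrable continuous_intros)
  finally show ?thesis by simp
qed

text \<open>By the addition formula and the vanishing sine coefficients, cosines are eigenfunctions
  of the convolution.\<close>

lemma conv_cos: "conv (\<lambda>t. cos (real m * t)) t = coef m * cos (real m * t)"
proof -
  have eq: "k x * cos (real m * (t - x)) =
      cos (real m * t) * (k x * cos (real m * x)) + sin (real m * t) * (k x * sin (real m * x))" for x
  proof -
    have "real m * (t - x) = real m * t - real m * x" by (simp add: algebra_simps)
    then show ?thesis by (simp only: cos_diff) (simp add: algebra_simps)
  qed
  have "conv (\<lambda>t. cos (real m * t)) t = (LINT x:{0..2 * pi}|lborel. cos (real m * t) * (k x * cos (real m * x)))
      + (LINT x:{0..2 * pi}|lborel. sin (real m * t) * (k x * sin (real m * x)))"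
    unfolding conv_def eq
    by (intro set_integral_add set_integrable_mult_right mult_integrable continuous_intros)
  then show ?thesis by (simp add: coef_def sin_coef_zero)
qed

lemma conv_diff:
  assumes "\<And>x. isCont F x" "\<And>x. isCont G x"
  shows "conv (\<lambda>t. F t - G t) t = conv F t - conv G t"
  unfolding conv_def right_diff_distrib
  by (intro set_integral_diff mult_integrable isCont_reflect assms)

lemma conv_cos_sum:
  "conv (\<lambda>t. \<Sum>m=1..N. a m * cos (real m * t)) t = (\<Sum>m=1..N. coef m * a m * cos (real m * t))"
proof (induction N)
  case (Suc N)
  have "conv (\<lambda>t. \<Sum>m=1..Suc N. a m * cos (real m * t)) t
      = conv (\<lambda>t. (\<Sum>m=1..N. a m * cos (real m * t)) + a (Suc N) * cos (real (Suc N) * t)) t"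
    by simp
  also have "\<dots> = conv (\<lambda>t. \<Sum>m=1..N. a m * cos (real m * t)) t + conv (\<lambda>t. a (Suc N) * cos (real (Suc N) * t)) t"
    unfolding conv_def distrib_left
    by (intro set_integral_add mult_integrable continuous_intros)
  moreover have "conv (\<lambda>t. a (Suc N) * cos (real (Suc N) * t)) t = a (Suc N) * conv (\<lambda>t. cos (real (Suc N) * t)) t"
    unfolding conv_def by (simp add: mult.left_commute[of _ "a (Suc N)"] del: of_nat_Suc)
  ultimately show ?case unfolding Suc conv_cos by (simp add: mult_ac)
qed (simp add: conv_def)

text \<open>Convolution is bounded in the sup norm by \<open>mass\<close>, so it may be applied
  termwise to a uniformly convergent cosine series.\<close>

lemma conv_uniform_limit:
  assumes F: "\<And>x. isCont F x"
    and lim: "uniform_limit UNIV (\<lambda>N t. \<Sum>m=1..N. a m * cos (real m * t)) F sequentially"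
  shows "uniform_limit UNIV (\<lambda>N t. \<Sum>m=1..N. coef m * a m * cos (real m * t)) (conv F) sequentially"
  unfolding uniform_limit_sequentially_iff
proof (intro allI impI)
  fix e :: real assume e: "0 < e"
  \<comment> \<open>Adding 1 keeps the quotient defined when \<open>mass\<close> is zero and makes
    the final inequality strict.\<close>
  define d where "d = e / (mass + 1)"
  have d: "0 < d" "mass * d < e" using e mass_nonneg by (auto simp: d_def field_simps)
  obtain N0 where N0: "\<bar>(\<Sum>m=1..N. a m * cos (real m * t)) - F t\<bar> < d" if "N0 \<le> N" for N t
    using lim d(1) unfolding uniform_limit_sequentially_iff dist_real_def by blast
  show "\<exists>N0. \<forall>N\<ge>N0. \<forall>t\<in>UNIV. dist (\<Sum>m=1..N. coef m * a m * cos (real m * t)) (conv F t) < e"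
  proof (intro exI[of _ N0] allI impI ballI)
    fix N t assume N: "N0 \<le> N"
    let ?S = "\<lambda>t. \<Sum>m=1..N. a m * cos (real m * t)"
    have S: "isCont ?S x" for x by (intro continuous_intros)
    have "\<bar>conv (\<lambda>t. ?S t - F t) t\<bar> \<le> mass * d"
      unfolding conv_def
      by (rule mult_bound) (use N0[OF N] in \<open>auto intro!: isCont_reflect continuous_intros F less_imp_le\<close>)
    then show "dist (\<Sum>m=1..N. coef m * a m * cos (real m * t)) (conv F t) < e"
      unfolding conv_diff[OF S F] conv_cos_sum dist_real_def using d(2) by linarith
  qed
qed

lemma conv_circle_Holder:
  assumes \<alpha>: "0 < \<alpha>" and F: "circle_Holder \<alpha> F"
  shows "circle_Holder \<alpha> (conv F)"
proof -
  obtain C where C: "0 \<le> C" "\<And>s t. norm (F s - F t) \<le> C * dist (cis s) (cis t) powr \<alpha>"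
    using circle_HolderE[OF F] by metis
  note cont = circle_Holder_continuous[OF \<alpha> F]
  have "\<bar>conv F s - conv F t\<bar> \<le> (mass * C) * dist (cis s) (cis t) powr \<alpha>" for s t
  proof -
    have "conv F s - conv F t = (LINT x:{0..2 * pi}|lborel. k x * (F (s - x) - F (t - x)))"
      unfolding conv_def right_diff_distrib
      by (intro set_integral_diff(2)[symmetric] mult_integrable isCont_reflect cont)
    also have "\<bar>\<dots>\<bar> \<le> mass * (C * dist (cis s) (cis t) powr \<alpha>)"
    proof (rule mult_bound)
      show "isCont (\<lambda>x. F (s - x) - F (t - x)) x" for x
        by (intro continuous_diff isCont_reflect cont)
      show "\<bar>F (s - x) - F (t - x)\<bar> \<le> C * dist (cis s) (cis t) powr \<alpha>" for x
        using C(2)[of "s - x" "t - x"] by (simp add: dist_cis_diff)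
    qed
    finally show ?thesis by simp
  qed
  then show ?thesis by (auto simp: circle_Holder_def)
qed

text \<open>By the mean value theorem the difference quotient of \<open>F\<close> differs from
  \<open>F'\<close> by at most C |h|^\<alpha>, uniformly in the base point. Integration against the
  kernel keeps this rate.\<close>

lemma conv_has_derivative:
  assumes \<alpha>: "0 < \<alpha>" and deriv: "\<And>t. (F has_real_derivative F' t) (at t)" and F': "circle_Holder \<alpha> F'"
  shows "(conv F has_real_derivative conv F' t) (at t)"
proof -
  obtain C where C: "0 \<le> C" "\<And>s t. norm (F' s - F' t) \<le> C * dist (cis s) (cis t) powr \<alpha>"
    using circle_HolderE[OF F'] by metis
  note contF' = circle_Holder_continuous[OF \<alpha> F']
  have contF: "isCont F x" for x using deriv DERIV_isCont by blast
  have quot: "\<bar>(F (s + h) - F s) / h - F' s\<bar> \<le> C * \<bar>h\<bar> powr \<alpha>" if h: "h \<noteq> 0" for s h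
  proof -
    obtain z where z: "\<bar>z - s\<bar> \<le> \<bar>h\<bar>" "F (s + h) - F s = h * F' z"
    proof (cases "0 < h")
      case True
      then show ?thesis using MVT2[of s "s + h" F F'] deriv that by force
    next
      case False
      then have "h < 0" using h by simp
      then obtain z where "s + h < z" "z < s" "F s - F (s + h) = (s - (s + h)) * F' z"
        using MVT2[of "s + h" s F F'] deriv by force
      then show ?thesis using that[of z] by (auto simp: algebra_simps)
    qed
    have "\<bar>(F (s + h) - F s) / h - F' s\<bar> = \<bar>F' z - F' s\<bar>" using z(2) h by simp
    also have "\<dots> \<le> C * dist (cis z) (cis s) powr \<alpha>" using C(2)[of z s] by simp
    also have "\<dots> \<le> C * \<bar>h\<bar> powr \<alpha>"
      using C(1) \<alpha> z(1)
      by (intro mult_left_mono order_trans[OF dist_cis_powr_le(2)[OF \<alpha>]] powr_mono2) auto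
    finally show ?thesis .
  qed
  have bound: "norm ((conv F (t + h) - conv F t) / h - conv F' t) \<le> mass * (C * \<bar>h\<bar> powr \<alpha>)" if h: "h \<noteq> 0" for h
  proof -
    have "(conv F (t + h) - conv F t) / h - conv F' t
        = (LINT x:{0..2 * pi}|lborel. k x * ((F (t - x + h) - F (t - x)) / h - F' (t - x)))"
    proof -
      have "k x * ((F (t - x + h) - F (t - x)) / h - F' (t - x))
          = (k x * F (t + h - x) - k x * F (t - x)) / h - k x * F' (t - x)" for x
        by (simp add: algebra_simps diff_divide_distrib)
      then show ?thesis unfolding conv_def
        by (simp add: set_integral_diff mult_integrable isCont_reflect contF contF')
    qed
    also have "norm \<dots> \<le> mass * (C * \<bar>h\<bar> powr \<alpha>)"
      unfolding real_norm_def using quot[OF h] h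
      by (intro mult_bound) (auto intro!: continuous_intros isCont_reflect contF' isCont_o2[OF _ contF])
    finally show ?thesis .
  qed
  have "((\<lambda>h. mass * (C * \<bar>h\<bar> powr \<alpha>)) \<longlongrightarrow> mass * (C * \<bar>0\<bar> powr \<alpha>)) (at 0)"
    using \<alpha> by (intro tendsto_intros tendsto_powr') auto
  then have lim: "((\<lambda>h. mass * (C * \<bar>h\<bar> powr \<alpha>)) \<longlongrightarrow> 0) (at 0)" using \<alpha> by simp
  have "((\<lambda>h. (conv F (t + h) - conv F t) / h - conv F' t) \<longlongrightarrow> 0) (at 0)"
    by (rule Lim_null_comparison[OF _ lim]) (use bound in \<open>auto simp: eventually_at_filter\<close>)
  then show ?thesis by (simp add: DERIV_def LIM_zero_iff)
qed

end

text \<open>Integrating a uniformly small partial sum against cos(j t) isolates pi times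
  \<open>b j\<close> by orthogonality, so |b j| is at most twice any positive bound.\<close>

lemma cos_series_zero:
  fixes b :: "nat \<Rightarrow> real"
  assumes lim: "uniform_limit UNIV (\<lambda>N t. \<Sum>m=1..N. b m * cos (real m * t)) (\<lambda>t. 0) sequentially"
    and j: "1 \<le> j"
  shows "b j = 0"
proof -
  have ortho: "((\<lambda>t. cos (real m * t) * cos (real j * t)) has_integral (if m = j then pi else 0)) {0..2 * pi}" for m
  proof -
    \<comment> \<open>Frequencies are integers here, because the difference of \<open>m\<close> and
      \<open>j\<close> may be negative.\<close>
    have int: "((\<lambda>t. cos (of_int i * t)) has_integral (if i = 0 then 2 * pi else 0)) {0..2 * pi}" for i :: int
    proof (cases "i = 0")
      case True
      then show ?thesis using has_integral_const_real[of "1::real" 0 "2 * pi"] by simp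
    next
      case False
      have "((\<lambda>t. cos (of_int i * t)) has_integral
          (sin (of_int i * (2 * pi)) / of_int i - sin (of_int i * 0) / of_int i)) {0..2 * pi}"
        using False by (intro fundamental_theorem_of_calculus)
          (auto intro!: derivative_eq_intros simp flip: has_real_derivative_iff_has_vector_derivative)
      moreover have "sin (of_int i * (2 * pi)) = 0"
        using sin.plus_of_int[of "0 :: real" i] by simp
      ultimately show ?thesis using False by simp
    qed
    have eq: "cos (real m * t) * cos (real j * t) =
        (cos (of_int (int m - int j) * t) + cos (of_int (int m + int j) * t)) / 2" for t
      by (simp add: cos_times_cos left_diff_distrib distrib_right)
    have "((\<lambda>t. cos (real m * t) * cos (real j * t)) has_integral
        ((if int m - int j = 0 then 2 * pi else 0) + (if int m + int j = 0 then 2 * pi else 0)) / 2) {0..2 * pi}"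
      unfolding eq by (intro has_integral_divide has_integral_add int)
    moreover have "((if int m - int j = 0 then 2 * pi else 0) + (if int m + int j = 0 then 2 * pi else 0)) / 2
        = (if m = j then pi else 0)"
      using j by auto
    ultimately show ?thesis by simp
  qed
  have "\<bar>b j\<bar> \<le> 2 * e" if e: "0 < e" for e
  proof -
    obtain N0 where N0: "\<bar>\<Sum>m=1..N. b m * cos (real m * t)\<bar> < e" if "N0 \<le> N" for N t
      using lim e unfolding uniform_limit_sequentially_iff dist_real_def diff_0_right by blast
    \<comment> \<open>The partial sum must be long enough to contain the index
      \<open>j\<close>.\<close>
    define N where "N = max N0 j"
    have int: "((\<lambda>t. (\<Sum>m=1..N. b m * (cos (real m * t) * cos (real j * t)))) has_integral
        (\<Sum>m=1..N. b m * (if m = j then pi else 0))) {0..2 * pi}"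
      by (intro has_integral_sum has_integral_mult_right ortho) auto
    have "(\<Sum>m=1..N. b m * (if m = j then pi else 0)) = b j * pi"
      using j by (simp add: N_def if_distrib cong: if_cong)
    then have int': "((\<lambda>t. (\<Sum>m=1..N. b m * cos (real m * t)) * cos (real j * t)) has_integral b j * pi) (cbox 0 (2 * pi))"
      using int by (simp add: sum_distrib_right mult.assoc)
    have "norm (b j * pi) \<le> e * measure lborel (cbox 0 (2 * pi))"
    proof (rule has_integral_bound[OF _ int'])
      fix t
      have "norm ((\<Sum>m=1..N. b m * cos (real m * t)) * cos (real j * t)) \<le> e * 1"
        unfolding norm_mult using N0[of N t]
        by (intro mult_mono) (auto simp: N_def)
      then show "norm ((\<Sum>m=1..N. b m * cos (real m * t)) * cos (real j * t)) \<le> e" by simp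
    qed (use e in simp)
    then show ?thesis by (simp add: abs_mult)
  qed
  then have "\<bar>b j\<bar> \<le> e" if "0 < e" for e using that[THEN half_gt_zero] by fastforce
  then show ?thesis by (metis abs_le_zero_iff dense_ge)
qed

section \<open>The linearized operator\<close>

context singular_kernel
begin

text \<open>The chord between \<open>cis t\<close> and \<open>cis \<eta>\<close> has length 2
  |sin((t - \<eta>)/2)|, so the integral part of \<open>L_op\<close> is convolution with this
  kernel, whose cosine coefficients are the values of \<open>lam K\<close>.\<close>

sublocale conv: even_periodic_kernel "\<lambda>x. K (2 * \<bar>sin (x / 2)\<bar>)"
proof
  have sets: "{x. 0 + 1 / 2 * x \<in> {0..pi}} = {0..2 * pi}" by auto
  have "set_integrable lborel {0..2 * pi} (\<lambda>x. K (2 * sin (x / 2)))"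
    using set_integrable_real_affine[OF integrable_sin, of "1 / 2" 0] unfolding sets by simp
  moreover have "set_integrable lborel {0..2 * pi} (\<lambda>x. K (2 * \<bar>sin (x / 2)\<bar>)) \<longleftrightarrow>
      set_integrable lborel {0..2 * pi} (\<lambda>x. K (2 * sin (x / 2)))"
    by (rule set_integrable_cong) (auto simp: sin_ge_zero)
  ultimately show "set_integrable lborel {0..2 * pi} (\<lambda>x. K (2 * \<bar>sin (x / 2)\<bar>))" by simp
qed (simp_all add: add_divide_distrib)

lemma coef_eq_lam: "conv.coef m = lam K m"
  by (simp add: conv.coef_def lam_def)

text \<open>On the circle \<open>L_op\<close> sees \<open>h\<close> only through this real function;
  the conjugate factor turns w^(m+1) into cos(m t).\<close>

definition "profile h t = Re (cnj (cis t) * h (cis t))"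

text \<open>The product rule brings \<open>h\<close> itself into the derivative of the profile, so
  the Hoelder bound is needed for \<open>h\<close> as well as for its derivative.\<close>

lemma profile_C1_Holder:
  assumes \<alpha>: "0 < \<alpha>" "\<alpha> < 1" and h: "h \<in> C1_Holder_circle \<alpha>"
  obtains F' where "\<And>t. (profile h has_real_derivative F' t) (at t)" "circle_Holder \<alpha> F'"
    and "circle_Holder \<alpha> (profile h)"
proof -
  obtain h' where h': "\<And>t. ((\<lambda>t. h (cis t)) has_vector_derivative h' t) (at t)" "circle_Holder \<alpha> h'"
    using h by (auto simp: C1_Holder_circle_iff)
  note hh = circle_Holder_of_deriv[OF \<alpha>(1) less_imp_le[OF \<alpha>(2)] h']
  note cnj = circle_Holder_bounded_linear[OF circle_Holder_cis[OF \<alpha>(1) less_imp_le[OF \<alpha>(2)]] bounded_linear_cnj]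
  let ?F' = "\<lambda>t. Re (cnj (cis t) * h' t + (- \<i>) * (cnj (cis t) * h (cis t)))"
  have "((\<lambda>t. cnj (cis t)) has_vector_derivative (- \<i> * cnj (cis t))) (at t)" for t
  proof -
    have "(cis has_vector_derivative (\<i> * cis t)) (at t)"
      using has_derivative_cis[of "\<lambda>t. t" "\<lambda>t. t" t UNIV]
      by (simp add: has_vector_derivative_def)
    then show ?thesis
      using bounded_linear.has_vector_derivative[OF bounded_linear_cnj] by fastforce
  qed
  then have "((\<lambda>t. cnj (cis t) * h (cis t)) has_vector_derivative
      cnj (cis t) * h' t + (- \<i> * cnj (cis t)) * h (cis t)) (at t)" for t
    by (intro has_vector_derivative_mult h')
  from bounded_linear.has_vector_derivative[OF bounded_linear_Re this]
  have "(profile h has_real_derivative ?F' t) (at t)" for t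
    unfolding profile_def[abs_def] by (simp add: has_real_derivative_iff_has_vector_derivative mult.assoc)
  moreover have "circle_Holder \<alpha> ?F'"
    by (intro circle_Holder_bounded_linear[OF _ bounded_linear_Re] circle_Holder_add
        circle_Holder_bounded_linear[OF _ bounded_linear_mult_right] circle_Holder_mult[OF \<alpha>(1)] cnj h'(2) hh)
  moreover have "circle_Holder \<alpha> (profile h)"
    unfolding profile_def[abs_def]
    by (intro circle_Holder_bounded_linear[OF _ bounded_linear_Re] circle_Holder_mult[OF \<alpha>(1)] cnj hh)
  ultimately show thesis by (rule that)
qed

lemma L_op_cis:
  assumes "\<And>x. isCont (profile h) x"
  shows "L_op K \<Omega> h (cis t) = (\<Omega> - lam K 1) * profile h t + conv.conv (profile h) t"
proof -
  have "(LINT \<eta>:{0..2 * pi}|lborel. K (cmod (cis t - cis \<eta>)) * Re (cnj (cis \<eta>) * h (cis \<eta>)))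
      = (LINT \<eta>:{0..2 * pi}|lborel. K (2 * \<bar>sin ((t - \<eta>) / 2)\<bar>) * profile h \<eta>)"
    by (simp add: profile_def flip: dist_cis dist_norm)
  also have "\<dots> = conv.conv (profile h) t"
    by (rule conv.conv_eq[OF assms]) (simp add: profile_def flip: cis_mult)
  finally show ?thesis by (simp add: L_op_def profile_def)
qed

lemma profile_uniform_limit:
  fixes a :: "nat \<Rightarrow> real"
  assumes "uniform_limit circle (\<lambda>N w. \<Sum>n=2..N. of_real (a n) * w ^ n) h sequentially"
  shows "uniform_limit UNIV (\<lambda>N t. \<Sum>m=1..N. a (Suc m) * cos (real m * t)) (profile h) sequentially"
  unfolding uniform_limit_sequentially_iff
proof (intro allI impI)
  fix e :: real assume "0 < e"
  then obtain N0 where N0: "\<And>N w. N0 \<le> N \<Longrightarrow> w \<in> circle \<Longrightarrow> dist (\<Sum>n=2..N. of_real (a n) * w ^ n) (h w) < e"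
    using assms unfolding uniform_limit_sequentially_iff by blast
  show "\<exists>N0. \<forall>N\<ge>N0. \<forall>t\<in>UNIV. dist (\<Sum>m=1..N. a (Suc m) * cos (real m * t)) (profile h t) < e"
  proof (intro exI[of _ N0] allI impI ballI)
    fix N t assume N: "N0 \<le> N"
    \<comment> \<open>The sum runs to \<open>Suc N\<close>, since multiplication by the conjugate
      lowers each exponent by one.\<close>
    let ?S = "\<Sum>n=2..Suc N. complex_of_real (a n) * cis t ^ n"
    have "cnj (cis t) * ?S = (\<Sum>m=1..N. complex_of_real (a (Suc m)) * cis (real m * t))"
    proof -
      have "?S = (\<Sum>m=1..N. complex_of_real (a (Suc m)) * cis t ^ Suc m)"
        using sum.shift_bounds_cl_Suc_ivl[of "\<lambda>n. complex_of_real (a n) * cis t ^ n" 1 N]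
        by (simp only: Suc_1)
      moreover have "cnj (cis t) * (x * cis t ^ Suc m) = x * cis (real m * t)" for x m
      proof -
        have "cnj (cis t) * (x * cis t ^ Suc m) = (cnj (cis t) * cis t) * x * cis t ^ m"
          by simp
        also have "cnj (cis t) * cis t = 1" by (simp add: cis_cnj cis_mult)
        finally show ?thesis by (simp only: mult_1 Complex.DeMoivre)
      qed
      ultimately show ?thesis by (simp only: sum_distrib_left)
    qed
    then have "Re (cnj (cis t) * ?S) = (\<Sum>m=1..N. a (Suc m) * cos (real m * t))"
      by (simp only: Re_sum) simp
    then have "(\<Sum>m=1..N. a (Suc m) * cos (real m * t)) - profile h t = Re (cnj (cis t) * (?S - h (cis t)))"
      by (simp only: profile_def right_diff_distrib minus_complex.sel)
    also have "\<bar>\<dots>\<bar> \<le> cmod (cnj (cis t) * (?S - h (cis t)))" by (rule abs_Re_le_cmod)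
    also have "\<dots> = dist ?S (h (cis t))" by (simp add: norm_mult dist_norm)
    also have "\<dots> < e" using N by (intro N0) auto
    finally show "dist (\<Sum>m=1..N. a (Suc m) * cos (real m * t)) (profile h t) < e"
      by (simp add: dist_real_def)
  qed
qed

text \<open>The operator is a Fourier multiplier: the local term contributes the constant \<Omega> -
  \<open>lam K 1\<close>, the convolution contributes \<open>lam K m\<close>.\<close>

lemma L_op_uniform_limit:
  assumes cont: "\<And>x. isCont (profile h) x"
    and lim: "uniform_limit circle (\<lambda>N w. \<Sum>n=2..N. of_real (a n) * w ^ n) h sequentially"
  shows "uniform_limit UNIV (\<lambda>N t. \<Sum>m=1..N. (\<Omega> - lam K 1 + lam K m) * a (Suc m) * cos (real m * t))
    (\<lambda>t. L_op K \<Omega> h (cis t)) sequentially"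
proof -
  note F = profile_uniform_limit[OF lim]
  have "uniform_limit UNIV (\<lambda>N t. (\<Omega> - lam K 1) * (\<Sum>m=1..N. a (Suc m) * cos (real m * t)))
      (\<lambda>t. (\<Omega> - lam K 1) * profile h t) sequentially"
    by (rule bounded_linear.uniform_limit[OF bounded_linear_mult_right F])
  from uniform_limit_add[OF this conv.conv_uniform_limit[OF cont F]]
  show ?thesis
    by (simp add: L_op_cis[OF cont] coef_eq_lam sum_distrib_left mult.assoc
        distrib_right sum.distrib)
qed

lemma circle_eq_cis: "w \<in> circle \<Longrightarrow> \<exists>t. w = cis t"
proof -
  assume "w \<in> circle"
  then have "w = cis (Arg w)" using rcis_cmod_Arg[of w] unfolding rcis_def by simp
  then show ?thesis by (rule exI)
qed

text \<open>Differentiation commutes with the convolution, which preserves Hoelder continuity; the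
  multiplier formula supplies the cosine series.\<close>

lemma L_op_in_Y_space:
  assumes \<alpha>: "0 < \<alpha>" "\<alpha> < 1" and h: "h \<in> X_space \<alpha>"
  shows "L_op K \<Omega> h \<in> Y_space \<alpha>"
proof -
  obtain a where hC: "h \<in> C1_Holder_circle \<alpha>"
    and lim: "uniform_limit circle (\<lambda>N w. \<Sum>n=2..N. of_real (a n) * w ^ n) h sequentially"
    using h by (auto simp: X_space_def)
  obtain F' where F': "\<And>t. (profile h has_real_derivative F' t) (at t)" "circle_Holder \<alpha> F'"
    using profile_C1_Holder[OF \<alpha> hC] by metis
  have cont: "isCont (profile h) x" for x using F'(1) DERIV_isCont by blast
  have "((\<lambda>t. L_op K \<Omega> h (cis t)) has_real_derivative (\<Omega> - lam K 1) * F' t + conv.conv F' t) (at t)" for t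
    unfolding L_op_cis[OF cont]
    by (intro DERIV_add DERIV_cmult F' conv.conv_has_derivative[OF \<alpha>(1) F'])
  moreover have "circle_Holder \<alpha> (\<lambda>t. (\<Omega> - lam K 1) * F' t + conv.conv F' t)"
    by (intro circle_Holder_add circle_Holder_bounded_linear[OF F'(2) bounded_linear_mult_right]
        conv.conv_circle_Holder[OF \<alpha>(1) F'(2)])
  ultimately have C1: "L_op K \<Omega> h \<in> C1_Holder_circle \<alpha>"
    unfolding C1_Holder_circle_iff has_real_derivative_iff_has_vector_derivative
    by (intro conjI exI) (auto simp add: L_op_def)
  have series: "uniform_limit circle (\<lambda>N w. \<Sum>m=1..N. (\<Omega> - lam K 1 + lam K m) * a (Suc m) * Re (w ^ m))
      (L_op K \<Omega> h) sequentially"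
    unfolding uniform_limit_iff
  proof (intro allI impI)
    fix e :: real assume "0 < e"
    with L_op_uniform_limit[OF cont lim, of \<Omega>]
    have "\<forall>\<^sub>F N in sequentially. \<forall>t\<in>UNIV. dist (\<Sum>m=1..N. (\<Omega> - lam K 1 + lam K m) * a (Suc m) * cos (real m * t))
        (L_op K \<Omega> h (cis t)) < e" unfolding uniform_limit_iff by blast
    then show "\<forall>\<^sub>F N in sequentially. \<forall>w\<in>circle. dist (\<Sum>m=1..N. (\<Omega> - lam K 1 + lam K m) * a (Suc m) * Re (w ^ m))
        (L_op K \<Omega> h w) < e"
      by eventually_elim (auto dest!: circle_eq_cis simp: Complex.DeMoivre)
  qed
  show ?thesis
    unfolding Y_space_def
    by (intro CollectI conjI C1 exI[of _ "\<lambda>m. (\<Omega> - lam K 1 + lam K m) * a (Suc m)"] series)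
qed

section \<open>Injectivity of the multipliers and the kernel of the operator\<close>

lemma lam_strict_antimono: "strict_antimono_on {1..} (lam K)"
  by (rule strict_antimono_on_from_1) (rule lam_bounds)

lemma lam_eq_iff: "1 \<le> m \<Longrightarrow> 1 \<le> n \<Longrightarrow> lam K m = lam K n \<longleftrightarrow> m = n"
  using monotone_onD[OF lam_strict_antimono, of m n] monotone_onD[OF lam_strict_antimono, of n m]
  by (cases m n rule: linorder_cases) auto

lemma circle_power_in_X_space:
  assumes \<alpha>: "0 < \<alpha>" "\<alpha> < 1" and m: "2 \<le> m"
  shows "fun_scale c (circle_power m) \<in> X_space \<alpha>"
    and "uniform_limit circle (\<lambda>N w. \<Sum>n=2..N. of_real (if n = m then c else 0) * w ^ n)
      (fun_scale c (circle_power m)) sequentially"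
proof -
  show lim: "uniform_limit circle (\<lambda>N w. \<Sum>n=2..N. of_real (if n = m then c else 0) * w ^ n)
      (fun_scale c (circle_power m)) sequentially"
    unfolding uniform_limit_sequentially_iff
  proof (intro allI impI exI[of _ m] ballI)
    fix e :: real and N :: nat and w :: complex
    assume "0 < e" "m \<le> N" "w \<in> circle"
    moreover have "(\<Sum>n=2..N. of_real (if n = m then c else 0) * w ^ n) =
        (\<Sum>n\<in>{2..N}. if n = m then of_real c * w ^ n else 0)" by (intro sum.cong) auto
    ultimately show "dist (\<Sum>n=2..N. of_real (if n = m then c else 0) * w ^ n)
        (fun_scale c (circle_power m) w) < e"
      using m by (simp add: fun_scale_def circle_power_def scaleR_conv_of_real)
  qed
  let ?f' = "\<lambda>t. (of_real (c * real m) * \<i>) * cis (real m * t)"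
  have D: "((\<lambda>t. fun_scale c (circle_power m) (cis t)) has_vector_derivative ?f' t) (at t)" for t
  proof -
    have "((\<lambda>t. c *\<^sub>R cis (real m * t)) has_vector_derivative ?f' t) (at t)"
      unfolding has_vector_derivative_def
      by (auto intro!: derivative_eq_intros simp: fun_eq_iff scaleR_conv_of_real)
    then show ?thesis by (simp add: fun_scale_def circle_power_def Complex.DeMoivre)
  qed
  have H: "circle_Holder \<alpha> ?f'"
  proof (intro circle_Holder_bounded_linear[OF _ bounded_linear_mult_right])
    show "circle_Holder \<alpha> (\<lambda>t. cis (real m * t))"
    proof (rule circle_Holder_Lipschitz[of _ "real m"])
      fix s t
      show "norm (cis (real m * s) - cis (real m * t)) \<le> real m * dist (cis s) (cis t)"
        \<comment> \<open>On the unit circle, taking \<open>m\<close>-th powers is Lipschitz with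
          constant \<open>m\<close>.\<close>
        using norm_power_diff[of "cis s" "cis t" m] by (simp add: Complex.DeMoivre dist_norm)
    qed (use \<alpha> in auto)
  qed
  have C1: "fun_scale c (circle_power m) \<in> C1_Holder_circle \<alpha>"
    unfolding C1_Holder_circle_iff
    by (intro conjI exI[of _ ?f'] allI impI D H) (simp add: fun_scale_def circle_power_def)
  show "fun_scale c (circle_power m) \<in> X_space \<alpha>"
    unfolding X_space_def
    by (intro CollectI conjI C1 exI[of _ "\<lambda>n. if n = m then c else 0"] lim)
qed

text \<open>At this \<Omega> the multiplier of mode \<open>m\<close> is
  \<open>lam K m - lam K n\<close>, which vanishes exactly for \<open>m = n\<close>. Uniqueness of
  cosine series then kills every coefficient of \<open>h\<close> but the one with index
  \<open>n + 1\<close>.\<close>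

lemma L_ker_eq_span:
  assumes \<alpha>: "0 < \<alpha>" "\<alpha> < 1" and n: "1 \<le> n" and \<Omega>: "\<Omega> = lam K 1 - lam K n"
  shows "L_ker \<alpha> K \<Omega> = funs.span {circle_power (n + 1)}"
  unfolding funs.span_singleton
proof (intro equalityI subsetI)
  fix h assume "h \<in> L_ker \<alpha> K \<Omega>"
  then have L0: "L_op K \<Omega> h w = 0" and hX: "h \<in> X_space \<alpha>" for w
    by (auto simp: L_ker_def fun_eq_iff)
  then obtain a where hC: "h \<in> C1_Holder_circle \<alpha>"
    and lim: "uniform_limit circle (\<lambda>N w. \<Sum>n=2..N. of_real (a n) * w ^ n) h sequentially"
    by (auto simp: X_space_def)
  have cont: "isCont (profile h) x" for x
    using profile_C1_Holder[OF \<alpha> hC] circle_Holder_continuous[OF \<alpha>(1)] by metis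
  have "(\<Omega> - lam K 1 + lam K m) * a (Suc m) = 0" if "1 \<le> m" for m
    by (rule cos_series_zero[OF _ that]) (use L_op_uniform_limit[OF cont lim, of \<Omega>] in \<open>simp only: L0\<close>)
  then have a0: "a (Suc m) = 0" if "1 \<le> m" "m \<noteq> n" for m
    using that n lam_eq_iff[of m n] by (force simp: \<Omega>)
  have h_eq: "h w = of_real (a (n + 1)) * w ^ (n + 1)" if w: "w \<in> circle" for w
  \<comment> \<open>The partial sums converge to \<open>h w\<close> and are constant from index
    \<open>n + 1\<close> on.\<close>
  proof (rule LIMSEQ_unique[OF tendsto_uniform_limitI[OF lim w]])
    have "(\<Sum>j=2..N. of_real (a j) * w ^ j) = of_real (a (n + 1)) * w ^ (n + 1)" if "n + 1 \<le> N" for N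
    proof -
      have "(\<Sum>j=2..N. of_real (a j) * w ^ j) = (\<Sum>j\<in>{2..N}. if j = n + 1 then of_real (a (n + 1)) * w ^ (n + 1) else 0)"
      proof (intro sum.cong refl)
        fix j assume "j \<in> {2..N}"
        then obtain m where "j = Suc m" "1 \<le> m" by (cases j) auto
        then show "of_real (a j) * w ^ j = (if j = n + 1 then of_real (a (n + 1)) * w ^ (n + 1) else 0)"
          using a0[of m] by auto
      qed
      then show ?thesis using n that by simp
    qed
    then show "(\<lambda>N. \<Sum>j=2..N. of_real (a j) * w ^ j) \<longlonglongrightarrow> of_real (a (n + 1)) * w ^ (n + 1)"
      by (intro tendsto_eventually) (auto simp: eventually_sequentially)
  qed
  have "h = fun_scale (a (n + 1)) (circle_power (n + 1))"
  proof
    fix w show "h w = fun_scale (a (n + 1)) (circle_power (n + 1)) w"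
      using h_eq[of w] hC
      by (cases "w \<in> circle")
        (auto simp: fun_scale_def circle_power_def scaleR_conv_of_real C1_Holder_circle_def)
  qed
  then show "h \<in> range (\<lambda>c. fun_scale c (circle_power (n + 1)))" by blast
next
  fix h assume "h \<in> range (\<lambda>c. fun_scale c (circle_power (n + 1)))"
  then obtain c where h: "h = fun_scale c (circle_power (n + 1))" by blast
  have hX: "h \<in> X_space \<alpha>"
    and lim: "uniform_limit circle (\<lambda>N w. \<Sum>j=2..N. of_real (if j = n + 1 then c else 0) * w ^ j) h sequentially"
    using circle_power_in_X_space[OF \<alpha>, of "n + 1" c] n unfolding h by auto
  have hC: "h \<in> C1_Holder_circle \<alpha>" using hX by (simp add: X_space_def)
  have cont: "isCont (profile h) x" for x
    using profile_C1_Holder[OF \<alpha> hC] circle_Holder_continuous[OF \<alpha>(1)] by metis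
  \<comment> \<open>For \<open>m = n\<close> the multiplier vanishes; for every other
    \<open>m\<close> the coefficient does.\<close>
  have zero: "(\<Omega> - lam K 1 + lam K m) * (if Suc m = n + 1 then c else 0) * cos (real m * t) = 0" for m t
    by (simp add: \<Omega>)
  have lim0: "uniform_limit UNIV (\<lambda>N t. 0) (\<lambda>t. L_op K \<Omega> h (cis t)) sequentially"
    using L_op_uniform_limit[OF cont lim, of \<Omega>] by (simp only: zero sum.neutral_const)
  have on_circle: "L_op K \<Omega> h (cis t) = 0" for t
    using LIMSEQ_unique[OF tendsto_uniform_limitI[OF lim0 UNIV_I] tendsto_const] .
  have "L_op K \<Omega> h w = 0" for w
  proof (cases "w \<in> circle")
    case True
    then show ?thesis using circle_eq_cis on_circle by metis
  qed (simp add: L_op_def)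
  then have "L_op K \<Omega> h = (\<lambda>w. 0)" by (rule ext)
  with hX show "h \<in> L_ker \<alpha> K \<Omega>" by (simp add: L_ker_def)
qed

lemma dim_L_ker:
  assumes "0 < \<alpha>" "\<alpha> < 1" "1 \<le> n" "\<Omega> = lam K 1 - lam K n"
  shows "funs.dim (L_ker \<alpha> K \<Omega>) = 1"
proof -
  have "circle_power (n + 1) 1 \<noteq> 0" by (simp add: circle_power_def)
  then have "circle_power (n + 1) \<noteq> 0" by (auto simp: fun_eq_iff)
  then show ?thesis
    unfolding L_ker_eq_span[OF assms] by (subst funs.dim_span_eq_card_independent) auto
qed

end

theorem proposition7p9p5:
  fixes K0 :: "real \<Rightarrow> real" and \<alpha> :: real
  assumes "0 < \<alpha>" and "\<alpha> < 1"
    and "smooth_pos K0"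
    and "completely_monotone (\<lambda>t. - deriv K0 t)"
    and "\<exists>t>0. - deriv K0 t \<noteq> 0"
    and "set_integrable lborel {0<..<1} (\<lambda>t. \<bar>K0 t\<bar> * t powr (- \<alpha>))"
  shows "((\<forall>n\<ge>1. \<forall>x>0. phi n x > 0) \<and> (\<forall>x>0. strict_antimono_on {1..} (\<lambda>n. phi n x)))
    \<and> ((\<forall>n\<ge>1. lam K0 n > 0) \<and> strict_antimono_on {1..} (lam K0))
    \<and> (\<forall>\<Omega> \<in> {lam K0 1 - lam K0 n | n. n \<ge> 1}.
           L_op K0 \<Omega> \<in> X_space \<alpha> \<rightarrow> Y_space \<alpha> \<and>
           funs.dim (L_ker \<alpha> K0 \<Omega>) = 1 \<and>
           (\<forall>n\<ge>1. \<Omega> = lam K0 1 - lam K0 n \<longrightarrow>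
              L_ker \<alpha> K0 \<Omega> = funs.span {circle_power (n + 1)}))"
proof -
  have "isCont K0 t" if "0 < t" for t
    using smooth_posD[OF assms(3) that, of 0] DERIV_isCont by fastforce
  then have "continuous_on {0<..<1} K0" by (intro continuous_at_imp_continuous_on) auto
  then have meas: "set_borel_measurable lborel {0<..<1} K0"
    using borel_measurable_continuous_on_indicator[of "{0<..<1}" K0]
    by (simp add: set_borel_measurable_def)
  \<comment> \<open>On (0, 1) the weight is at least 1, so weighted integrability yields that of
    \<open>K0\<close> itself.\<close>
  have "norm (K0 t) \<le> norm (\<bar>K0 t\<bar> * t powr (- \<alpha>))" if "t \<in> {0<..<1}" for t
  proof -
    have "1 \<le> t powr (- \<alpha>)" using that assms(1) powr_mono'[of "- \<alpha>" 0 t] by auto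
    then show ?thesis using mult_left_mono[of 1 "t powr (- \<alpha>)" "\<bar>K0 t\<bar>"] by simp
  qed
  then have "set_integrable lborel {0<..<1} K0"
    by (intro set_integrable_bound[OF assms(6) meas]) simp
  then interpret singular_kernel K0
    by (rule singular_kernel.intro[OF assms(3-5)])
  have phi: "strict_antimono_on {1..} (\<lambda>n. phi n x)" if "0 < x" for x
    by (rule strict_antimono_on_from_1) (rule phi_bounds(2)[OF _ that])
  show ?thesis
  proof (intro conjI ballI allI impI)
    fix \<Omega> assume "\<Omega> \<in> {lam K0 1 - lam K0 n | n. n \<ge> 1}"
    then show "funs.dim (L_ker \<alpha> K0 \<Omega>) = 1"
      using dim_L_ker[OF assms(1,2)] by blast
    show "L_op K0 \<Omega> \<in> X_space \<alpha> \<rightarrow> Y_space \<alpha>"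
      using L_op_in_Y_space[OF assms(1,2)] by blast
  qed (use phi phi_bounds(1) lam_bounds(1) lam_strict_antimono L_ker_eq_span[OF assms(1,2)] in auto)
qed

end
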